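(* Let $\Pi_1$ and $\Pi_2$ be two bivector fields on manifolds $M_1$ and $M_2$ respectively. Let $f_1$ and $f_2$ be smooth functions on $M_1$ and $M_2$ respectively and let $X_{f_1}=\sharp_{\Pi_1}(df_1)$ and $X_{f_2}=\sharp_{\Pi_2}(df_2)$ be the corresponding Hamiltonian vector fields. Then the bivector field $\Pi_{f_1,f_2}=X_{f_1}^h\wedge X_{f_2}^v$ is a Poisson tensor on $M_1\times M_2$.
   Context: A bivector field $\Pi$ is a Poisson tensor if $[\Pi,\Pi]_S=0$ for the Schouten–Nijenhuis bracket, equivalently if $\{\varphi,\psi\}=\Pi(d\varphi,d\psi)$ satisfies the Jacobi identity. The anchor map $\sharp_\Pi:T^*M\to TM$ is defined by $\beta(\sharp_\Pi(\alpha))=\Pi(\alpha,\beta)$. With $\sigma_i:M_1\times M_2\to M_i$ the projections, the horizontal lift $X_1^h$ of a vector field $X_1$ on $M_1$ is the unique vector field on $M_1\times M_2$ with $d\sigma_1(X_1^h)=X_1$ and $d\sigma_2(X_1^h)=0$; the vertical lift $X_2^v$ of a vector field $X_2$ on $M_2$ is the unique vector field with $d\sigma_1(X_2^v)=0$ and $d\sigma_2(X_2^v)=X_2$. *)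

theory Defs
  imports "HOL-Analysis.Analysis"
begin

primrec k_smooth_on ::
  "nat \<Rightarrow> 'e::real_normed_vector set \<Rightarrow> ('e \<Rightarrow> 'f::real_normed_vector) \<Rightarrow> bool" where
  "k_smooth_on 0 S f \<longleftrightarrow> continuous_on S f"
| "k_smooth_on (Suc k) S f \<longleftrightarrow>
     (\<forall>x\<in>S. f differentiable (at x)) \<and>
     (\<forall>v. k_smooth_on k S (\<lambda>x. frechet_derivative f (at x) v))"

text \<open>Intended for open sets \<open>S\<close> in finite-dimensional spaces, where it is the usual notion of a
  \<open>C\<^sup>\<infinity>\<close> function.\<close>

definition smooth_on ::
  "'e::real_normed_vector set \<Rightarrow> ('e \<Rightarrow> 'f::real_normed_vector) \<Rightarrow> bool" where
  "smooth_on S f \<longleftrightarrow> (\<forall>k. k_smooth_on k S f)"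

text \<open>A chart is a pair \<open>(U, c)\<close> of a domain and a coordinate map.  The atlas need not be maximal:
  all notions below depend only on the smooth structure that it generates.  The model space is a
  finite-dimensional inner product space rather than an \<open>euclidean_space\<close>, because the latter class
  excludes dimension 0.\<close>

record ('a, 'e) mfd =
  mtop :: "'a topology"
  atlas :: "('a set \<times> ('a \<Rightarrow> 'e)) set"

definition smooth_manifold :: "('a, 'e::real_inner) mfd \<Rightarrow> bool" where
  "smooth_manifold M \<longleftrightarrow>
     (\<exists>B::'e set. finite B \<and> span B = UNIV) \<and>
     Hausdorff_space (mtop M) \<and> second_countable (mtop M) \<and>
     (\<Union>(U, c)\<in>atlas M. U) = topspace (mtop M) \<and>
     (\<forall>(U, c)\<in>atlas M. openin (mtop M) U \<and> open (c ` U) \<and>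
        homeomorphic_map (subtopology (mtop M) U) (top_of_set (c ` U)) c) \<and>
     (\<forall>(U, c)\<in>atlas M. \<forall>(V, d)\<in>atlas M. smooth_on (c ` (U \<inter> V)) (d \<circ> inv_into U c))"

definition prod_mfd ::
  "('a, 'e::real_inner) mfd \<Rightarrow> ('b, 'f::real_inner) mfd \<Rightarrow> ('a \<times> 'b, 'e \<times> 'f) mfd" where
  "prod_mfd M N =
     \<lparr>mtop = prod_topology (mtop M) (mtop N),
      atlas = {(U \<times> V, map_prod c d) | U V c d. (U, c) \<in> atlas M \<and> (V, d) \<in> atlas N}\<rparr>"

definition smooth_fun_on :: "('a, 'e::real_inner) mfd \<Rightarrow> 'a set \<Rightarrow> ('a \<Rightarrow> real) \<Rightarrow> bool" where
  "smooth_fun_on M W f \<longleftrightarrow>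
     (\<forall>(U, c)\<in>atlas M. smooth_on (c ` (U \<inter> W)) (f \<circ> inv_into U c))"

definition smooth_near :: "('a, 'e::real_inner) mfd \<Rightarrow> 'a \<Rightarrow> ('a \<Rightarrow> real) \<Rightarrow> bool" where
  "smooth_near M p f \<longleftrightarrow> (\<exists>W. openin (mtop M) W \<and> p \<in> W \<and> smooth_fun_on M W f)"

definition smooth_curve_at :: "('a, 'e::real_inner) mfd \<Rightarrow> 'a \<Rightarrow> (real \<Rightarrow> 'a) \<Rightarrow> bool" where
  "smooth_curve_at M p \<gamma> \<longleftrightarrow> \<gamma> 0 = p \<and>
     (\<exists>e>0. continuous_map (top_of_set {-e<..<e}) (mtop M) \<gamma> \<and>
        (\<forall>(U, c)\<in>atlas M. smooth_on ({-e<..<e} \<inter> \<gamma> -` U) (c \<circ> \<gamma>)))"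

text \<open>Tangent vectors are velocities of smooth curves, represented by their action on functions that
  are smooth near the base point.  They vanish on all other functions, so that equality of tangent
  vectors is equality of HOL functions; cotangent vectors and vector fields are likewise set to 0
  off their domains.\<close>

definition velocity :: "('a, 'e::real_inner) mfd \<Rightarrow> (real \<Rightarrow> 'a) \<Rightarrow> ('a \<Rightarrow> real) \<Rightarrow> real" where
  "velocity M \<gamma> = (\<lambda>f. if smooth_near M (\<gamma> 0) f then deriv (f \<circ> \<gamma>) 0 else 0)"

definition tangent_space :: "('a, 'e::real_inner) mfd \<Rightarrow> 'a \<Rightarrow> (('a \<Rightarrow> real) \<Rightarrow> real) set" where
  "tangent_space M p = {velocity M \<gamma> | \<gamma>. smooth_curve_at M p \<gamma>}"

definition cotangent_space ::
  "('a, 'e::real_inner) mfd \<Rightarrow> 'a \<Rightarrow> ((('a \<Rightarrow> real) \<Rightarrow> real) \<Rightarrow> real) set" where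
  "cotangent_space M p =
     {\<alpha>. (\<forall>v\<in>tangent_space M p. \<forall>w\<in>tangent_space M p. \<forall>a b.
            \<alpha> (\<lambda>f. a * v f + b * w f) = a * \<alpha> v + b * \<alpha> w) \<and>
         (\<forall>v. v \<notin> tangent_space M p \<longrightarrow> \<alpha> v = 0)}"

definition diff_at ::
  "('a, 'e::real_inner) mfd \<Rightarrow> ('a \<Rightarrow> real) \<Rightarrow> 'a \<Rightarrow> (('a \<Rightarrow> real) \<Rightarrow> real) \<Rightarrow> real" where
  "diff_at M f p = (\<lambda>v. if v \<in> tangent_space M p then v f else 0)"

definition pushforward ::
  "('b, 'f::real_inner) mfd \<Rightarrow> ('a \<Rightarrow> 'b) \<Rightarrow> 'a \<Rightarrow> (('a \<Rightarrow> real) \<Rightarrow> real) \<Rightarrow> ('b \<Rightarrow> real) \<Rightarrow> real" where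
  "pushforward N F p v = (\<lambda>g. if smooth_near N (F p) g then v (g \<circ> F) else 0)"

definition vector_field ::
  "('a, 'e::real_inner) mfd \<Rightarrow> ('a \<Rightarrow> ('a \<Rightarrow> real) \<Rightarrow> real) \<Rightarrow> bool" where
  "vector_field M X \<longleftrightarrow>
     (\<forall>p\<in>topspace (mtop M). X p \<in> tangent_space M p) \<and>
     (\<forall>p. p \<notin> topspace (mtop M) \<longrightarrow> X p = (\<lambda>f. 0)) \<and>
     (\<forall>W f. openin (mtop M) W \<and> smooth_fun_on M W f \<longrightarrow> smooth_fun_on M W (\<lambda>p. X p f))"

text \<open>A bivector at \<open>p\<close> is an alternating bilinear form on the cotangent space at \<open>p\<close>; its values
  on other arguments are irrelevant.\<close>

type_synonym 'a bivector_family =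
  "'a \<Rightarrow> ((('a \<Rightarrow> real) \<Rightarrow> real) \<Rightarrow> real) \<Rightarrow> ((('a \<Rightarrow> real) \<Rightarrow> real) \<Rightarrow> real) \<Rightarrow> real"

definition bivector_field :: "('a, 'e::real_inner) mfd \<Rightarrow> 'a bivector_family \<Rightarrow> bool" where
  "bivector_field M P \<longleftrightarrow>
     (\<forall>p\<in>topspace (mtop M). \<forall>\<alpha>\<in>cotangent_space M p. \<forall>\<beta>\<in>cotangent_space M p.
        P p \<alpha> \<beta> = - P p \<beta> \<alpha> \<and>
        (\<forall>\<gamma>\<in>cotangent_space M p. \<forall>a b.
           P p (\<lambda>v. a * \<alpha> v + b * \<beta> v) \<gamma> = a * P p \<alpha> \<gamma> + b * P p \<beta> \<gamma>)) \<and>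
     (\<forall>W f g. openin (mtop M) W \<and> smooth_fun_on M W f \<and> smooth_fun_on M W g \<longrightarrow>
        smooth_fun_on M W (\<lambda>p. P p (diff_at M f p) (diff_at M g p)))"

definition bracket ::
  "('a, 'e::real_inner) mfd \<Rightarrow> 'a bivector_family \<Rightarrow> ('a \<Rightarrow> real) \<Rightarrow> ('a \<Rightarrow> real) \<Rightarrow> 'a \<Rightarrow> real" where
  "bracket M P \<phi> \<psi> = (\<lambda>p. P p (diff_at M \<phi> p) (diff_at M \<psi> p))"

text \<open>The condition \<open>[P, P] = 0\<close> for the Schouten--Nijenhuis bracket, in its equivalent form as the
  Jacobi identity.\<close>

definition poisson_tensor :: "('a, 'e::real_inner) mfd \<Rightarrow> 'a bivector_family \<Rightarrow> bool" where
  "poisson_tensor M P \<longleftrightarrow> bivector_field M P \<and>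
     (\<forall>\<phi> \<psi> \<theta>.
        smooth_fun_on M (topspace (mtop M)) \<phi> \<and> smooth_fun_on M (topspace (mtop M)) \<psi> \<and>
        smooth_fun_on M (topspace (mtop M)) \<theta> \<longrightarrow>
        (\<forall>p\<in>topspace (mtop M).
           bracket M P (bracket M P \<phi> \<psi>) \<theta> p + bracket M P (bracket M P \<psi> \<theta>) \<phi> p +
           bracket M P (bracket M P \<theta> \<phi>) \<psi> p = 0))"

definition anchor ::
  "('a, 'e::real_inner) mfd \<Rightarrow> 'a bivector_family \<Rightarrow> 'a \<Rightarrow> ((('a \<Rightarrow> real) \<Rightarrow> real) \<Rightarrow> real) \<Rightarrow>
     ('a \<Rightarrow> real) \<Rightarrow> real" where
  "anchor M P p \<alpha> =
     (THE v. v \<in> tangent_space M p \<and> (\<forall>\<beta>\<in>cotangent_space M p. \<beta> v = P p \<alpha> \<beta>))"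

definition hamiltonian_field ::
  "('a, 'e::real_inner) mfd \<Rightarrow> 'a bivector_family \<Rightarrow> ('a \<Rightarrow> real) \<Rightarrow> 'a \<Rightarrow> ('a \<Rightarrow> real) \<Rightarrow> real" where
  "hamiltonian_field M P f =
     (\<lambda>p. if p \<in> topspace (mtop M) then anchor M P p (diff_at M f p) else (\<lambda>g. 0))"

definition horizontal_lift ::
  "('a, 'e::real_inner) mfd \<Rightarrow> ('b, 'f::real_inner) mfd \<Rightarrow> ('a \<Rightarrow> ('a \<Rightarrow> real) \<Rightarrow> real) \<Rightarrow>
     'a \<times> 'b \<Rightarrow> ('a \<times> 'b \<Rightarrow> real) \<Rightarrow> real" where
  "horizontal_lift M N X =
     (THE Z. vector_field (prod_mfd M N) Z \<and>
        (\<forall>z\<in>topspace (mtop (prod_mfd M N)).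
           pushforward M fst z (Z z) = X (fst z) \<and> pushforward N snd z (Z z) = (\<lambda>g. 0)))"

definition vertical_lift ::
  "('a, 'e::real_inner) mfd \<Rightarrow> ('b, 'f::real_inner) mfd \<Rightarrow> ('b \<Rightarrow> ('b \<Rightarrow> real) \<Rightarrow> real) \<Rightarrow>
     'a \<times> 'b \<Rightarrow> ('a \<times> 'b \<Rightarrow> real) \<Rightarrow> real" where
  "vertical_lift M N Y =
     (THE Z. vector_field (prod_mfd M N) Z \<and>
        (\<forall>z\<in>topspace (mtop (prod_mfd M N)).
           pushforward M fst z (Z z) = (\<lambda>g. 0) \<and> pushforward N snd z (Z z) = Y (snd z)))"

definition wedge ::
  "('a \<Rightarrow> ('a \<Rightarrow> real) \<Rightarrow> real) \<Rightarrow> ('a \<Rightarrow> ('a \<Rightarrow> real) \<Rightarrow> real) \<Rightarrow> 'a bivector_family" where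
  "wedge X Y = (\<lambda>p \<alpha> \<beta>. \<alpha> (X p) * \<beta> (Y p) - \<alpha> (Y p) * \<beta> (X p))"

end

theory Submission
  imports Defs
begin

text \<open>The horizontal lift \<open>A\<close> of \<open>X\<^bsub>f1\<^esub>\<close> and the vertical lift \<open>B\<close> of \<open>X\<^bsub>f2\<^esub>\<close> commute, because in product
  coordinates the coefficients of \<open>A\<close> depend only on the first factor, those of \<open>B\<close> only on the second,
  and mixed second derivatives are symmetric.  For commuting derivations \<open>A\<close> and \<open>B\<close> the bracket
  \<open>{\<phi>, \<psi>} = A\<phi> B\<psi> - B\<phi> A\<psi>\<close> satisfies the Jacobi identity by the Leibniz rule and cancellation.
  That the Hamiltonian fields are smooth vector fields rests on the identification of tangent
  vectors with coordinate vectors in a chart, and on finite-dimensional duality.\<close>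

subsection \<open>Calculus of smooth maps\<close>

text \<open>Two features of the definitions shape the proof. \<open>anchor\<close>,
  \<open>horizontal_lift\<close> and \<open>vertical_lift\<close> are definite descriptions, about
  which nothing can be said before unique existence is shown. And \<open>tangent_space\<close> is a
  set of velocities of curves, not visibly a vector space. \<open>chart_vector\<close> answers both:
  it parametrises the tangent vectors at a point linearly and injectively by the model space, and
  the chart components \<open>c q \<bullet> b\<close> are test functions that recover the parameter.
  Since tangent vectors act on every function that is smooth near the base point, these local
  components can be used directly, without cut-off functions. Many guards below have a single
  purpose: a function must be known to be smooth near the point, because otherwise a tangent vector
  takes its default value 0 on it.\<close>

lemma frechet_derivativeI: "(f has_derivative f') (at x) \<Longrightarrow> frechet_derivative f (at x) = f'"
  using frechet_derivative_at by metis

text \<open>On an open set the values of f determine its derivative at each point, so the agreement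
  passes to all directional derivatives and the induction closes.\<close>

lemma k_smooth_on_cong:
  assumes "open S" "k_smooth_on k S f" "\<And>x. x \<in> S \<Longrightarrow> f x = g x"
  shows "k_smooth_on k S g"
  using assms(2,3)
proof (induction k arbitrary: f g)
  case 0
  then show ?case
    using continuous_on_cong by (metis k_smooth_on.simps(1))
next
  case (Suc k)
  have d: "(g has_derivative frechet_derivative f (at x)) (at x)" if "x \<in> S" for x
    using has_derivative_transform_within_open[OF _ \<open>open S\<close> that Suc.prems(2)] Suc.prems(1) that
    by (simp add: frechet_derivative_works)
  show ?case
    unfolding k_smooth_on.simps
  proof (intro conjI ballI allI)
    show "g differentiable at x" if "x \<in> S" for x
      using d[OF that] by (auto simp: differentiable_def)
    show "k_smooth_on k S (\<lambda>x. frechet_derivative g (at x) v)" for v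
      by (rule Suc.IH[of "\<lambda>x. frechet_derivative f (at x) v"])
        (use Suc.prems frechet_derivativeI[OF d] in \<open>auto\<close>)
  qed
qed

text \<open>Allows each closure property to be proved from an explicit derivative formula instead of
  the derivative selected by \<open>frechet_derivative\<close>.\<close>

lemma k_smooth_on_SucI:
  assumes "open S" "\<And>x. x \<in> S \<Longrightarrow> (f has_derivative f' x) (at x)"
    and "\<And>v. k_smooth_on k S (\<lambda>x. f' x v)"
  shows "k_smooth_on (Suc k) S f"
  unfolding k_smooth_on.simps
proof (intro conjI ballI allI)
  show "f differentiable at x" if "x \<in> S" for x
    using assms(2)[OF that] by (auto simp: differentiable_def)
  show "k_smooth_on k S (\<lambda>x. frechet_derivative f (at x) v)" for v
    by (rule k_smooth_on_cong[OF \<open>open S\<close> assms(3)]) (simp add: frechet_derivativeI[OF assms(2)])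
qed

text \<open>The recursion at \<open>Suc k\<close> speaks only of derivatives, so the step down has
  to be proved. The product rule needs it for its undifferentiated factor.\<close>

lemma k_smooth_on_SucD: "k_smooth_on (Suc k) S f \<Longrightarrow> k_smooth_on k S f"
proof (induction k arbitrary: f)
  case 0
  then show ?case
    by (auto intro!: continuous_at_imp_continuous_on differentiable_imp_continuous_within)
qed (auto simp: Ball_def)

lemma k_smooth_on_has_derivative:
  "\<lbrakk>k_smooth_on (Suc k) S f; x \<in> S\<rbrakk> \<Longrightarrow> (f has_derivative frechet_derivative f (at x)) (at x)"
  by (simp add: frechet_derivative_works)

lemma k_smooth_on_subset: "\<lbrakk>k_smooth_on k S f; T \<subseteq> S\<rbrakk> \<Longrightarrow> k_smooth_on k T f"
  by (induction k arbitrary: f) (auto intro: continuous_on_subset)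

lemma k_smooth_on_const:
  assumes "open S"
  shows "k_smooth_on k S (\<lambda>x. a)"
proof (induction k arbitrary: a)
  case (Suc k)
  show ?case
    by (rule k_smooth_on_SucI[OF assms has_derivative_const Suc])
qed simp

lemma k_smooth_on_linear_comp:
  assumes L: "bounded_linear L" and "open S"
  shows "k_smooth_on k S f \<Longrightarrow> k_smooth_on k S (\<lambda>x. L (f x))"
proof (induction k arbitrary: f)
  case 0
  then show ?case
    using bounded_linear.continuous_on[OF L] by simp
next
  case (Suc k)
  show ?case
    by (rule k_smooth_on_SucI[OF \<open>open S\<close> bounded_linear.has_derivative[OF L k_smooth_on_has_derivative[OF Suc.prems]] Suc.IH])
       (use Suc.prems in auto)
qed

text \<open>Affine inner maps suffice, as the inner maps that occur are projections of a product and
  straight lines in a chart. Their derivative \<open>L\<close> is constant, so a directional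
  derivative of the composite has the same shape, with f replaced by its derivative along
  \<open>L v\<close>, and the induction closes.\<close>

lemma k_smooth_on_comp_affine:
  assumes L: "bounded_linear L" and "open T" and sub: "\<And>x. x \<in> T \<Longrightarrow> a + L x \<in> S"
  shows "k_smooth_on k S f \<Longrightarrow> k_smooth_on k T (\<lambda>x. f (a + L x))"
proof (induction k arbitrary: f)
  case 0
  have "continuous_on T (\<lambda>x. a + L x)"
    by (intro continuous_intros bounded_linear.continuous_on[OF L])
  then show ?case
    using 0 sub by (auto intro: continuous_on_compose2)
next
  case (Suc k)
  have d: "((\<lambda>x. a + L x) has_derivative L) (at x)" for x
    using bounded_linear.has_derivative[OF L has_derivative_ident]
    by (auto intro!: derivative_eq_intros)
  have "((\<lambda>x. f (a + L x)) has_derivative (\<lambda>v. frechet_derivative f (at (a + L x)) (L v))) (at x)"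
    if "x \<in> T" for x
    using has_derivative_compose[OF d k_smooth_on_has_derivative[OF Suc.prems sub[OF that]]] .
  then show ?case
    by (rule k_smooth_on_SucI[OF \<open>open T\<close> _ Suc.IH]) (use Suc.prems in auto)
qed

lemma k_smooth_on_add:
  assumes "open S"
  shows "\<lbrakk>k_smooth_on k S f; k_smooth_on k S g\<rbrakk> \<Longrightarrow> k_smooth_on k S (\<lambda>x. f x + g x)"
proof (induction k arbitrary: f g)
  case 0
  then show ?case by (simp add: continuous_on_add)
next
  case (Suc k)
  show ?case
    by (rule k_smooth_on_SucI[OF assms has_derivative_add[OF
          k_smooth_on_has_derivative[OF Suc.prems(1)] k_smooth_on_has_derivative[OF Suc.prems(2)]] Suc.IH])
       (use Suc.prems in auto)
qed

lemma k_smooth_on_mult: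
  fixes f g :: "'e::real_normed_vector \<Rightarrow> real"
  assumes "open S"
  shows "\<lbrakk>k_smooth_on k S f; k_smooth_on k S g\<rbrakk> \<Longrightarrow> k_smooth_on k S (\<lambda>x. f x * g x)"
proof (induction k arbitrary: f g)
  case 0
  then show ?case by (simp add: continuous_on_mult)
next
  case (Suc k)
  show ?case
    by (rule k_smooth_on_SucI[OF assms has_derivative_mult[OF
          k_smooth_on_has_derivative[OF Suc.prems(1)] k_smooth_on_has_derivative[OF Suc.prems(2)]]
          k_smooth_on_add[OF assms Suc.IH Suc.IH]])
       (use Suc.prems k_smooth_on_SucD in auto)
qed

lemma smooth_on_cong:
  "\<lbrakk>open S; smooth_on S f; \<And>x. x \<in> S \<Longrightarrow> f x = g x\<rbrakk> \<Longrightarrow> smooth_on S g"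
  using k_smooth_on_cong unfolding smooth_on_def by metis

lemma smooth_on_subset: "\<lbrakk>smooth_on S f; T \<subseteq> S\<rbrakk> \<Longrightarrow> smooth_on T f"
  using k_smooth_on_subset unfolding smooth_on_def by metis

lemma smooth_on_const: "open S \<Longrightarrow> smooth_on S (\<lambda>x. a)"
  using k_smooth_on_const unfolding smooth_on_def by metis

lemma smooth_on_linear_comp:
  "\<lbrakk>bounded_linear L; open S; smooth_on S f\<rbrakk> \<Longrightarrow> smooth_on S (\<lambda>x. L (f x))"
  using k_smooth_on_linear_comp unfolding smooth_on_def by metis

lemma smooth_on_comp_affine:
  "\<lbrakk>bounded_linear L; open T; smooth_on S f; \<And>x. x \<in> T \<Longrightarrow> a + L x \<in> S\<rbrakk>
    \<Longrightarrow> smooth_on T (\<lambda>x. f (a + L x))"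
  using k_smooth_on_comp_affine[of L T a S] unfolding smooth_on_def by metis

lemma smooth_on_add: "\<lbrakk>open S; smooth_on S f; smooth_on S g\<rbrakk> \<Longrightarrow> smooth_on S (\<lambda>x. f x + g x)"
  using k_smooth_on_add unfolding smooth_on_def by metis

lemma smooth_on_mult:
  fixes f g :: "'e::real_normed_vector \<Rightarrow> real"
  shows "\<lbrakk>open S; smooth_on S f; smooth_on S g\<rbrakk> \<Longrightarrow> smooth_on S (\<lambda>x. f x * g x)"
  using k_smooth_on_mult unfolding smooth_on_def by metis

lemma smooth_on_minus:
  "\<lbrakk>open S; smooth_on S f; smooth_on S g\<rbrakk> \<Longrightarrow> smooth_on S (\<lambda>x. f x - g x)"
  using smooth_on_add[of S f "\<lambda>x. - g x"] smooth_on_linear_comp[of uminus S g]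
    bounded_linear_minus[OF bounded_linear_ident] by auto

lemma smooth_on_sum:
  "\<lbrakk>open S; \<And>i. i \<in> I \<Longrightarrow> smooth_on S (f i)\<rbrakk> \<Longrightarrow> smooth_on S (\<lambda>x. \<Sum>i\<in>I. f i x)"
  by (induction I rule: infinite_finite_induct) (simp_all add: smooth_on_const smooth_on_add)

lemma smooth_on_Pair:
  assumes "open S" "smooth_on S f" "smooth_on S g"
  shows "smooth_on S (\<lambda>x. (f x, g x))"
proof -
  have "bounded_linear (\<lambda>y. (y, 0))" "bounded_linear (\<lambda>y. (0, y))"
    by (intro bounded_linear_Pair bounded_linear_ident bounded_linear_zero)+
  then show ?thesis
    using smooth_on_add[OF assms(1)
        smooth_on_linear_comp[of "\<lambda>y. (y, 0)", OF _ assms(1,2)]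
        smooth_on_linear_comp[of "\<lambda>y. (0, y)", OF _ assms(1,3)]] by simp
qed

lemma smooth_on_fst:
  assumes "open S" "open T" "smooth_on S f"
  shows "smooth_on (S \<times> T) (\<lambda>z. f (fst z))"
  using smooth_on_comp_affine[OF bounded_linear_fst open_Times[OF assms(1,2)] assms(3), of 0] by auto

lemma smooth_on_snd:
  assumes "open S" "open T" "smooth_on T f"
  shows "smooth_on (S \<times> T) (\<lambda>z. f (snd z))"
  using smooth_on_comp_affine[OF bounded_linear_snd open_Times[OF assms(1,2)] assms(3), of 0] by auto

lemma smooth_on_deriv: "smooth_on S f \<Longrightarrow> smooth_on S (\<lambda>x. frechet_derivative f (at x) v)"
  unfolding smooth_on_def by (metis k_smooth_on.simps(2))

lemma smooth_on_has_derivative: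
  "\<lbrakk>smooth_on S f; x \<in> S\<rbrakk> \<Longrightarrow> (f has_derivative frechet_derivative f (at x)) (at x)"
  unfolding smooth_on_def using k_smooth_on_has_derivative by metis

lemma smooth_on_has_line_derivative:
  fixes f :: "'e::real_normed_vector \<Rightarrow> real"
  assumes "smooth_on S f" "x + t *\<^sub>R a \<in> S"
  shows "((\<lambda>t. f (x + t *\<^sub>R a)) has_real_derivative frechet_derivative f (at (x + t *\<^sub>R a)) a) (at t)"
proof -
  have "((\<lambda>t. x + t *\<^sub>R a) has_derivative (\<lambda>h. h *\<^sub>R a)) (at t)"
    by (auto intro!: derivative_eq_intros)
  from has_derivative_compose[OF this smooth_on_has_derivative[OF assms]]
  have "((\<lambda>t. f (x + t *\<^sub>R a)) has_derivative (\<lambda>h. frechet_derivative f (at (x + t *\<^sub>R a)) (h *\<^sub>R a))) (at t)" .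
  moreover have "linear (frechet_derivative f (at (x + t *\<^sub>R a)))"
    using smooth_on_has_derivative[OF assms] has_derivative_linear by blast
  ultimately show ?thesis
    unfolding has_field_derivative_def by (simp add: linear_scale mult_commute_abs)
qed

text \<open>A derivative in direction a sees only the restriction to the line through x along a;
  elsewhere f and g may differ. This is what permits freezing the coefficients of a vector
  field.\<close>

lemma frechet_derivative_eq_on_line:
  fixes f g :: "'e::real_normed_vector \<Rightarrow> real"
  assumes "smooth_on S f" "smooth_on S g" "open S" "x \<in> S"
    and "\<And>t. x + t *\<^sub>R a \<in> S \<Longrightarrow> f (x + t *\<^sub>R a) = g (x + t *\<^sub>R a)"
  shows "frechet_derivative f (at x) a = frechet_derivative g (at x) a"
proof -
  have o: "open ((\<lambda>t. x + t *\<^sub>R a) -` S)"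
    by (rule continuous_open_vimage[OF \<open>open S\<close>]) (auto intro!: continuous_intros)
  have "((\<lambda>t. g (x + t *\<^sub>R a)) has_real_derivative frechet_derivative f (at x) a) (at 0)"
    by (rule has_field_derivative_transform_within_open[OF _ o, of "\<lambda>t. f (x + t *\<^sub>R a)"])
      (use smooth_on_has_line_derivative[OF assms(1), of x 0 a] assms(4,5) in auto)
  then show ?thesis
    using smooth_on_has_line_derivative[OF assms(2), of x 0 a] assms(4) DERIV_unique by fastforce
qed

subsection \<open>Symmetry of second derivatives\<close>

text \<open>Two applications of the mean value theorem: to the b-increment of f as a function of the
  a-parameter, then to the derivative along a as a function of the b-parameter. The second
  difference is symmetric in a and b, which makes the two orders of differentiation
  comparable.\<close>

lemma second_difference_MVT:
  fixes f :: "'e::real_normed_vector \<Rightarrow> real"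
  assumes f: "smooth_on S f" and t: "0 < t"
    and S: "\<And>r s. \<lbrakk>0 \<le> r; r \<le> t; 0 \<le> s; s \<le> t\<rbrakk> \<Longrightarrow> x + r *\<^sub>R a + s *\<^sub>R b \<in> S"
  shows "\<exists>r s. 0 < r \<and> r < t \<and> 0 < s \<and> s < t \<and>
    f (x + t *\<^sub>R a + t *\<^sub>R b) - f (x + t *\<^sub>R a) - f (x + t *\<^sub>R b) + f x
    = t * (t * frechet_derivative (\<lambda>y. frechet_derivative f (at y) a) (at (x + r *\<^sub>R a + s *\<^sub>R b)) b)"
proof -
  let ?D = "\<lambda>y. frechet_derivative f (at y) a"
  define h where "h r = f (x + t *\<^sub>R b + r *\<^sub>R a) - f (x + r *\<^sub>R a)" for r
  have dh: "(h has_real_derivative ?D (x + t *\<^sub>R b + r *\<^sub>R a) - ?D (x + r *\<^sub>R a)) (at r)"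
    if "0 \<le> r" "r \<le> t" for r
    unfolding h_def
    by (intro DERIV_diff smooth_on_has_line_derivative[OF f])
      (use that t S[of r t] S[of r 0] in \<open>auto simp: add_ac\<close>)
  obtain r where r: "0 < r" "r < t"
    "h t - h 0 = (t - 0) * (?D (x + t *\<^sub>R b + r *\<^sub>R a) - ?D (x + r *\<^sub>R a))"
    using MVT2[OF t dh] by blast
  have dk: "((\<lambda>s. ?D (x + r *\<^sub>R a + s *\<^sub>R b)) has_real_derivative
      frechet_derivative ?D (at (x + r *\<^sub>R a + s *\<^sub>R b)) b) (at s)"
    if "0 \<le> s" "s \<le> t" for s
    by (intro smooth_on_has_line_derivative[OF smooth_on_deriv[OF f]]) (use that r S[of r s] in auto)
  obtain s where s: "0 < s" "s < t"
    "?D (x + r *\<^sub>R a + t *\<^sub>R b) - ?D (x + r *\<^sub>R a + 0 *\<^sub>R b)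
      = (t - 0) * frechet_derivative ?D (at (x + r *\<^sub>R a + s *\<^sub>R b)) b"
    using MVT2[OF t dk] by blast
  have "h t - h 0 = t * (t * frechet_derivative ?D (at (x + r *\<^sub>R a + s *\<^sub>R b)) b)"
  proof -
    have "x + t *\<^sub>R b + r *\<^sub>R a = x + r *\<^sub>R a + t *\<^sub>R b"
      by (simp add: add_ac)
    with r(3) s(3) show ?thesis by (simp only: diff_zero scaleR_zero_left add_0_right)
  qed
  moreover have "h t - h 0 = f (x + t *\<^sub>R a + t *\<^sub>R b) - f (x + t *\<^sub>R a) - f (x + t *\<^sub>R b) + f x"
    unfolding h_def by (simp add: add_ac)
  ultimately show ?thesis
    using r(1,2) s(1,2) by (intro exI[of _ r] exI[of _ s] conjI) simp_all
qed

text \<open>The same second difference is written by \<open>second_difference_MVT\<close> in both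
  orders. Cancelling t twice gives equal mixed derivatives at two points near x, and continuity of
  both mixed derivatives finishes.\<close>

lemma symmetric_second_derivative:
  fixes f :: "'e::real_normed_vector \<Rightarrow> real"
  assumes f: "smooth_on S f" and "open S" "x \<in> S"
  shows "frechet_derivative (\<lambda>y. frechet_derivative f (at y) a) (at x) b
       = frechet_derivative (\<lambda>y. frechet_derivative f (at y) b) (at x) a"
proof -
  define D where "D a b y = frechet_derivative (\<lambda>y. frechet_derivative f (at y) a) (at y) b" for a b y
  have "smooth_on S (D a b)" for a b
    unfolding D_def by (intro smooth_on_deriv f)
  then have "continuous_on S (D a b)" for a b
    unfolding smooth_on_def by (metis k_smooth_on.simps(1))
  then have isC: "isCont (D a b) x" for a b
    using \<open>open S\<close> \<open>x \<in> S\<close> continuous_on_eq_continuous_at by blast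
  have "\<bar>D a b x - D b a x\<bar> < e" if "e > 0" for e
  proof -
    obtain d1 where d1: "d1 > 0" "\<And>y. dist y x < d1 \<Longrightarrow> dist (D a b y) (D a b x) < e/2"
      using isC[of a b] half_gt_zero[OF \<open>e > 0\<close>] unfolding continuous_at_eps_delta by blast
    obtain d2 where d2: "d2 > 0" "\<And>y. dist y x < d2 \<Longrightarrow> dist (D b a y) (D b a x) < e/2"
      using isC[of b a] half_gt_zero[OF \<open>e > 0\<close>] unfolding continuous_at_eps_delta by blast
    obtain d3 where d3: "d3 > 0" "ball x d3 \<subseteq> S"
      using \<open>open S\<close> \<open>x \<in> S\<close> open_contains_ball by blast
    define d where "d = min d1 (min d2 d3)"
    \<comment> \<open>Chosen so that the parallelogram with sides t a and t b lies within distance d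
      of x; the 1 keeps the denominator positive when a and b vanish and makes the bound
      strict.\<close>
    define t where "t = d / (norm a + norm b + 1)"
    have "d > 0" using d1 d2 d3 by (simp add: d_def)
    then have t: "t > 0" unfolding t_def by (intro divide_pos_pos) (auto intro: add_nonneg_pos)
    have near: "dist (x + r *\<^sub>R a + s *\<^sub>R b) x < d" if "0 \<le> r" "r \<le> t" "0 \<le> s" "s \<le> t" for r s
    proof -
      have "dist (x + r *\<^sub>R a + s *\<^sub>R b) x \<le> norm (r *\<^sub>R a) + norm (s *\<^sub>R b)"
        using norm_triangle_ineq[of "r *\<^sub>R a" "s *\<^sub>R b"] by (simp add: dist_norm add.assoc)
      also have "\<dots> \<le> t * norm a + t * norm b"
        using that by (auto intro!: add_mono mult_right_mono)
      also have "\<dots> < t * (norm a + norm b + 1)"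
        using t by (simp add: algebra_simps)
      also have "\<dots> = d"
        unfolding t_def using add_nonneg_nonneg[OF norm_ge_zero[of a] norm_ge_zero[of b]]
        by (simp, linarith)
      finally show ?thesis .
    qed
    have inS: "x + r *\<^sub>R a + s *\<^sub>R b \<in> S" if "0 \<le> r" "r \<le> t" "0 \<le> s" "s \<le> t" for r s
      using near[OF that] d3(2) by (auto simp: d_def dist_commute)
    have inS': "x + r *\<^sub>R b + s *\<^sub>R a \<in> S" if "0 \<le> r" "r \<le> t" "0 \<le> s" "s \<le> t" for r s
      using inS[of s r] that by (simp add: add_ac)
    have "\<exists>r s. 0 < r \<and> r < t \<and> 0 < s \<and> s < t \<and>
      f (x + t *\<^sub>R a + t *\<^sub>R b) - f (x + t *\<^sub>R a) - f (x + t *\<^sub>R b) + f x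
        = t * (t * D a b (x + r *\<^sub>R a + s *\<^sub>R b))"
      unfolding D_def by (rule second_difference_MVT[OF f t]) (erule (3) inS)
    then obtain r s where 1: "0 < r" "r < t" "0 < s" "s < t"
      "f (x + t *\<^sub>R a + t *\<^sub>R b) - f (x + t *\<^sub>R a) - f (x + t *\<^sub>R b) + f x
        = t * (t * D a b (x + r *\<^sub>R a + s *\<^sub>R b))"
      by metis
    have "\<exists>r s. 0 < r \<and> r < t \<and> 0 < s \<and> s < t \<and>
      f (x + t *\<^sub>R b + t *\<^sub>R a) - f (x + t *\<^sub>R b) - f (x + t *\<^sub>R a) + f x
        = t * (t * D b a (x + r *\<^sub>R b + s *\<^sub>R a))"
      unfolding D_def by (rule second_difference_MVT[OF f t]) (erule (3) inS')
    then obtain r' s' where 2: "0 < r'" "r' < t" "0 < s'" "s' < t"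
      "f (x + t *\<^sub>R b + t *\<^sub>R a) - f (x + t *\<^sub>R b) - f (x + t *\<^sub>R a) + f x
        = t * (t * D b a (x + r' *\<^sub>R b + s' *\<^sub>R a))"
      by metis
    \<comment> \<open>The first parameter always belongs to the direction differentiated first, so
      after the exchange s' goes with a and r' with b.\<close>
    have "D a b (x + r *\<^sub>R a + s *\<^sub>R b) = D b a (x + s' *\<^sub>R a + r' *\<^sub>R b)"
    proof -
      have "t * (t * D a b (x + r *\<^sub>R a + s *\<^sub>R b)) = t * (t * D b a (x + r' *\<^sub>R b + s' *\<^sub>R a))"
        unfolding 1(5)[symmetric] 2(5)[symmetric] by (simp add: add_ac)
      then show ?thesis using t by (simp add: add_ac)
    qed
    moreover have "dist (D a b (x + r *\<^sub>R a + s *\<^sub>R b)) (D a b x) < e/2"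
      by (intro d1) (use near[of r s] 1 in \<open>auto simp: d_def\<close>)
    moreover have "dist (D b a (x + s' *\<^sub>R a + r' *\<^sub>R b)) (D b a x) < e/2"
      by (intro d2) (use near[of s' r'] 2 in \<open>auto simp: d_def\<close>)
    ultimately show ?thesis
      unfolding dist_real_def by linarith
  qed
  \<comment> \<open>With the difference itself as e, the bound reads e < e unless the difference is
    0.\<close>
  from this[of "\<bar>D a b x - D b a x\<bar>"] have "D a b x = D b a x"
    by (cases "D a b x = D b a x") simp_all
  then show ?thesis by (simp add: D_def)
qed

subsection \<open>Charts and tangent vectors\<close>

text \<open>The part of \<^const>\<open>smooth_manifold\<close> that the proof uses; unlike second countability, it passes to
  products without further work.\<close>

definition smooth_atlas :: "('a, 'e::real_inner) mfd \<Rightarrow> bool" where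
  "smooth_atlas M \<longleftrightarrow>
     (\<exists>B::'e set. finite B \<and> span B = UNIV) \<and>
     (\<Union>(U, c)\<in>atlas M. U) = topspace (mtop M) \<and>
     (\<forall>(U, c)\<in>atlas M. openin (mtop M) U \<and> open (c ` U) \<and>
        homeomorphic_map (subtopology (mtop M) U) (top_of_set (c ` U)) c) \<and>
     (\<forall>(U, c)\<in>atlas M. \<forall>(V, d)\<in>atlas M. smooth_on (c ` (U \<inter> V)) (d \<circ> inv_into U c))"

lemma smooth_atlasD:
  assumes M: "smooth_atlas M"
  shows "(\<Union>(U, c)\<in>atlas M. U) = topspace (mtop M)"
    and "(U, c) \<in> atlas M \<Longrightarrow> openin (mtop M) U \<and> open (c ` U) \<and>
        homeomorphic_map (subtopology (mtop M) U) (top_of_set (c ` U)) c"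
    and "\<lbrakk>(U, c) \<in> atlas M; (V, d) \<in> atlas M\<rbrakk> \<Longrightarrow> smooth_on (c ` (U \<inter> V)) (d \<circ> inv_into U c)"
proof -
  note * = M[unfolded smooth_atlas_def, THEN conjunct2]
  show "(\<Union>(U, c)\<in>atlas M. U) = topspace (mtop M)"
    by (rule conjunct1[OF *])
  show "openin (mtop M) U \<and> open (c ` U) \<and>
        homeomorphic_map (subtopology (mtop M) U) (top_of_set (c ` U)) c" if "(U, c) \<in> atlas M"
    using bspec[OF conjunct1[OF conjunct2[OF *]] that] by simp
  show "smooth_on (c ` (U \<inter> V)) (d \<circ> inv_into U c)"
    if "(U, c) \<in> atlas M" "(V, d) \<in> atlas M"
    using bspec[OF conjunct2[OF conjunct2[OF *]] that(1)] that(2) by auto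
qed

lemma smooth_manifold_imp_smooth_atlas: "smooth_manifold M \<Longrightarrow> smooth_atlas M"
  by (simp add: smooth_manifold_def smooth_atlas_def)

text \<open>The directional derivative along u in a chart. The default value 0 copies that of
  \<open>velocity\<close>, so that the two can be equal as functions.\<close>

definition chart_vector ::
  "('a, 'e::real_inner) mfd \<Rightarrow> 'a set \<Rightarrow> ('a \<Rightarrow> 'e) \<Rightarrow> 'a \<Rightarrow> 'e \<Rightarrow> ('a \<Rightarrow> real) \<Rightarrow> real" where
  "chart_vector M U c p u =
     (\<lambda>f. if smooth_near M p f then frechet_derivative (f \<circ> inv_into U c) (at (c p)) u else 0)"

text \<open>The model space comes with a finite spanning set but no chosen basis; orthogonalising
  that set gives explicit coefficients. A zero vector in B is harmless, since its summand is
  0.\<close>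

lemma orthogonal_expansion:
  fixes M :: "('a, 'e::real_inner) mfd"
  assumes "smooth_atlas M"
  obtains B :: "'e set" where "finite B" "\<And>u. (\<Sum>b\<in>B. (u \<bullet> b / (b \<bullet> b)) *\<^sub>R b) = u"
proof -
  obtain B0 :: "'e set" where B0: "finite B0" "span B0 = UNIV"
    using conjunct1[OF assms[unfolded smooth_atlas_def]] by blast
  obtain B :: "'e set" where B: "finite B" "span B = UNIV" "pairwise orthogonal B"
    using basis_orthogonal[OF B0(1)] unfolding B0(2) by blast
  have "(\<Sum>b\<in>B. (u \<bullet> b / (b \<bullet> b)) *\<^sub>R b) = u" if "u \<in> B" for u
  proof -
    have "(\<Sum>b\<in>B. (u \<bullet> b / (b \<bullet> b)) *\<^sub>R b) = (\<Sum>b\<in>B. if b = u then u else 0)"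
      using B(3) that by (intro sum.cong) (auto simp: pairwise_def orthogonal_def)
    then show ?thesis
      using B(1) that by simp
  qed
  moreover have "linear (\<lambda>u. \<Sum>b\<in>B. (u \<bullet> b / (b \<bullet> b)) *\<^sub>R b)"
    by (rule linearI)
      (simp_all add: inner_add_left add_divide_distrib scaleR_left_distrib sum.distrib scaleR_sum_right)
  ultimately have "(\<Sum>b\<in>B. (u \<bullet> b / (b \<bullet> b)) *\<^sub>R b) = u" for u
    using linear_eq_on[of "\<lambda>u. \<Sum>b\<in>B. (u \<bullet> b / (b \<bullet> b)) *\<^sub>R b" id u B] B(2) by (simp add: linear_id)
  then show ?thesis
    using that B(1) by blast
qed

lemma frechet_derivative_mult:
  fixes f g :: "'e::real_normed_vector \<Rightarrow> real"
  assumes "(f has_derivative f') (at x)" "(g has_derivative g') (at x)"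
  shows "frechet_derivative (\<lambda>x. f x * g x) (at x) u = f x * g' u + f' u * g x"
  using frechet_derivativeI[OF has_derivative_mult[OF assms]] by simp

locale manifold_chart =
  fixes M :: "('a, 'e::real_inner) mfd" and U :: "'a set" and c :: "'a \<Rightarrow> 'e"
  assumes smooth_atlas: "smooth_atlas M" and chart: "(U, c) \<in> atlas M"
begin

abbreviation "ci \<equiv> inv_into U c"

lemma openin_chart: "openin (mtop M) U"
  and open_chart_image: "open (c ` U)"
  and homeomorphic_map_chart: "homeomorphic_map (subtopology (mtop M) U) (top_of_set (c ` U)) c"
  using smooth_atlasD(2)[OF smooth_atlas chart] by auto

lemma chart_subset: "U \<subseteq> topspace (mtop M)"
  by (simp add: openin_chart openin_subset)

lemma inj_on_chart: "inj_on c U"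
  using homeomorphic_map_chart chart_subset
  by (simp add: homeomorphic_eq_everything_map Int_absorb1)

lemma ci_c [simp]: "p \<in> U \<Longrightarrow> ci (c p) = p"
  by (simp add: inj_on_chart)

lemma open_image_Int:
  assumes "openin (mtop M) W"
  shows "open (c ` (U \<inter> W))"
proof -
  have "openin (subtopology (mtop M) U) (U \<inter> W)"
    using assms by (simp add: openin_subtopology_Int2)
  then have "openin (top_of_set (c ` U)) (c ` (U \<inter> W))"
    using homeomorphic_imp_open_map[OF homeomorphic_map_chart] by (simp add: open_map_def)
  then show ?thesis
    using open_chart_image by (simp add: openin_open_eq)
qed

lemma continuous_map_ci: "continuous_map (top_of_set (c ` U)) (mtop M) ci"
proof -
  obtain g where g: "homeomorphic_maps (subtopology (mtop M) U) (top_of_set (c ` U)) c g"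
    using homeomorphic_map_chart homeomorphic_map_maps by blast
  then have "continuous_map (top_of_set (c ` U)) (mtop M) g"
    by (auto simp: homeomorphic_maps_def continuous_map_in_subtopology)
  moreover have "g y = ci y" if "y \<in> c ` U" for y
    using g that chart_subset by (auto simp: homeomorphic_maps_def Int_absorb1)
  ultimately show ?thesis
    by (auto intro: continuous_map_eq)
qed

lemma smooth_fun_onD: "smooth_fun_on M W f \<Longrightarrow> smooth_on (c ` (U \<inter> W)) (f \<circ> ci)"
  using chart by (auto simp: smooth_fun_on_def)

lemma smooth_near_has_derivative:
  assumes "p \<in> U" "smooth_near M p f"
  shows "((f \<circ> ci) has_derivative frechet_derivative (f \<circ> ci) (at (c p))) (at (c p))"
proof -
  obtain W where W: "p \<in> W" "smooth_fun_on M W f"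
    using assms unfolding smooth_near_def by blast
  show ?thesis
    by (rule smooth_on_has_derivative[OF smooth_fun_onD[OF W(2)]]) (use assms W in auto)
qed

text \<open>For parameters near 0 the curve stays in U, where \<open>f \<circ> \<gamma>\<close>
  factors as \<open>f \<circ> ci\<close> after \<open>c \<circ> \<gamma>\<close>; the chain rule
  gives the claim.\<close>

lemma velocity_eq_chart_vector:
  assumes p: "p \<in> U" and \<gamma>: "smooth_curve_at M p \<gamma>"
  shows "velocity M \<gamma> = chart_vector M U c p (frechet_derivative (c \<circ> \<gamma>) (at 0) 1)"
proof
  fix f
  have \<gamma>0: "\<gamma> 0 = p"
    using \<gamma> by (simp add: smooth_curve_at_def)
  obtain e where e: "e > 0" "continuous_map (top_of_set {-e<..<e}) (mtop M) \<gamma>"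
    and sm: "smooth_on ({-e<..<e} \<inter> \<gamma> -` U) (c \<circ> \<gamma>)"
    using \<gamma> chart unfolding smooth_curve_at_def by blast
  have "openin (top_of_set {-e<..<e}) {t \<in> topspace (top_of_set {-e<..<e}). \<gamma> t \<in> U}"
    by (rule openin_continuous_map_preimage[OF e(2) openin_chart])
  then have "openin (top_of_set {-e<..<e}) ({-e<..<e} \<inter> \<gamma> -` U)"
    by (simp add: Int_def vimage_def)
  then have I: "open ({-e<..<e} \<inter> \<gamma> -` U)"
    by (rule openin_open_trans) simp
  have I0: "0 \<in> {-e<..<e} \<inter> \<gamma> -` U"
    using e(1) p \<gamma>0 by simp
  let ?h = "frechet_derivative (c \<circ> \<gamma>) (at 0)"
  have dh: "((c \<circ> \<gamma>) has_derivative ?h) (at 0)"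
    by (rule smooth_on_has_derivative[OF sm I0])
  show "velocity M \<gamma> f = chart_vector M U c p (?h 1) f"
  proof (cases "smooth_near M p f")
    case True
    let ?F = "frechet_derivative (f \<circ> ci) (at (c p))"
    have dF: "((f \<circ> ci) has_derivative ?F) (at ((c \<circ> \<gamma>) 0))"
      using smooth_near_has_derivative[OF p True] \<gamma>0 by simp
    have "((\<lambda>t. (f \<circ> ci) ((c \<circ> \<gamma>) t)) has_derivative (\<lambda>t. ?F (?h t))) (at 0)"
      by (rule has_derivative_compose[OF dh dF])
    then have "((f \<circ> \<gamma>) has_derivative (\<lambda>t. ?F (?h t))) (at 0)"
      by (rule has_derivative_transform_within_open[OF _ I I0]) auto
    moreover have "(\<lambda>t. ?F (?h t)) = (*) (?F (?h 1))"
    proof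
      fix t
      have "linear (\<lambda>t. ?F (?h t))"
        using linear_compose[OF has_derivative_linear[OF dh] has_derivative_linear[OF dF]]
        by (simp add: o_def)
      from linear_scale[OF this, of t 1] show "?F (?h t) = ?F (?h 1) * t" by simp
    qed
    ultimately have "((f \<circ> \<gamma>) has_real_derivative ?F (?h 1)) (at 0)"
      unfolding has_field_derivative_def by simp
    then show ?thesis
      using True \<gamma>0 by (simp add: velocity_def chart_vector_def DERIV_imp_deriv)
  qed (simp add: velocity_def chart_vector_def \<gamma>0)
qed

text \<open>The witness is the straight line through \<open>c p\<close> in direction u, carried back
  by the chart. Its smoothness must be checked in every chart of the atlas, which is where
  smoothness of the transition maps enters.\<close>

lemma chart_vector_in_tangent_space:
  assumes p: "p \<in> U"
  shows "chart_vector M U c p u \<in> tangent_space M p"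
proof -
  define A where "A t = c p + t *\<^sub>R u" for t
  define \<gamma> where "\<gamma> t = ci (A t)" for t
  have A: "continuous_on X A" for X
    unfolding A_def by (intro continuous_intros)
  have "open (A -` (c ` U))"
    by (rule continuous_open_vimage[OF open_chart_image]) (use A[of UNIV] in \<open>simp add: continuous_on_eq_continuous_at\<close>)
  moreover have "0 \<in> A -` (c ` U)"
    using p by (simp add: A_def)
  ultimately obtain e where e: "e > 0" "ball 0 e \<subseteq> A -` (c ` U)"
    using open_contains_ball by blast
  \<comment> \<open>Within this interval the line stays in the image of the chart, where
    \<open>ci\<close> really is the inverse of c.\<close>
  then have Ae: "A t \<in> c ` U" if "t \<in> {-e<..<e}" for t
    using that by (auto simp: subset_iff dist_real_def)
  have \<gamma>0: "\<gamma> 0 = p"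
    using p by (simp add: \<gamma>_def A_def)
  have contA: "continuous_map (top_of_set {-e<..<e}) (top_of_set (c ` U)) A"
    using A Ae by auto
  have "\<gamma> = ci \<circ> A"
    by (auto simp: \<gamma>_def)
  then have cont: "continuous_map (top_of_set {-e<..<e}) (mtop M) \<gamma>"
    using continuous_map_compose[OF contA continuous_map_ci] by simp
  have sm: "smooth_on ({-e<..<e} \<inter> \<gamma> -` V) (d \<circ> \<gamma>)" if "(V, d) \<in> atlas M" for V d
  proof -
    interpret V: manifold_chart M V d
      by unfold_locales (use smooth_atlas that in auto)
    have sub: "{-e<..<e} \<inter> \<gamma> -` V = {-e<..<e} \<inter> A -` (c ` (U \<inter> V))"
    proof -
      have "\<gamma> t \<in> V \<longleftrightarrow> A t \<in> c ` (U \<inter> V)" if t: "t \<in> {-e<..<e}" for t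
      proof -
        obtain q where "q \<in> U" "A t = c q"
          using Ae[OF t] by blast
        then show ?thesis
          using inj_on_chart by (auto simp: \<gamma>_def dest: inj_onD)
      qed
      then show ?thesis
        by blast
    qed
    have "open ({-e<..<e} \<inter> A -` (c ` (U \<inter> V)))"
      by (intro open_Int open_greaterThanLessThan continuous_open_vimage open_image_Int V.openin_chart)
        (use A[of UNIV] in \<open>simp add: continuous_on_eq_continuous_at\<close>)
    moreover have "smooth_on (c ` (U \<inter> V)) (d \<circ> ci)"
      by (rule smooth_atlasD(3)[OF smooth_atlas chart that])
    ultimately have "smooth_on ({-e<..<e} \<inter> A -` (c ` (U \<inter> V))) (\<lambda>t. (d \<circ> ci) (c p + t *\<^sub>R u))"
      by (rule smooth_on_comp_affine[OF bounded_linear_scaleR_left]) (simp add: A_def)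
    then show ?thesis
      unfolding sub by (simp add: \<gamma>_def[abs_def] A_def o_def)
  qed
  have \<gamma>: "smooth_curve_at M p \<gamma>"
    unfolding smooth_curve_at_def using e(1) cont sm \<gamma>0 by blast
  have "(A has_derivative (\<lambda>t. t *\<^sub>R u)) (at 0)"
    unfolding A_def by (auto intro!: derivative_eq_intros)
  then have "((c \<circ> \<gamma>) has_derivative (\<lambda>t. t *\<^sub>R u)) (at 0)"
    by (rule has_derivative_transform_within_open[of _ _ _ _ "{-e<..<e}"])
      (use e(1) Ae in \<open>auto simp: \<gamma>_def f_inv_into_f\<close>)
  then have "frechet_derivative (c \<circ> \<gamma>) (at 0) 1 = u"
    by (simp add: frechet_derivativeI)
  then have "chart_vector M U c p u = velocity M \<gamma>"
    using velocity_eq_chart_vector[OF p \<gamma>] by simp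
  then show ?thesis
    using \<gamma> unfolding tangent_space_def by blast
qed

lemma tangent_space_eq: "p \<in> U \<Longrightarrow> tangent_space M p = range (chart_vector M U c p)"
proof (intro subset_antisym subsetI)
  fix v assume "p \<in> U" "v \<in> tangent_space M p"
  then show "v \<in> range (chart_vector M U c p)"
    unfolding tangent_space_def using velocity_eq_chart_vector by blast
qed (use chart_vector_in_tangent_space in blast)

text \<open>Seen in another chart, a coordinate function is a component of a transition map.\<close>

lemma smooth_fun_on_coord: "smooth_fun_on M U (\<lambda>q. c q \<bullet> b)"
  unfolding smooth_fun_on_def
proof clarify
  fix V d assume V: "(V, d) \<in> atlas M"
  interpret V: manifold_chart M V d
    by unfold_locales (use smooth_atlas V in auto)
  have "smooth_on (d ` (V \<inter> U)) (c \<circ> inv_into V d)"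
    by (rule smooth_atlasD(3)[OF smooth_atlas V chart])
  from smooth_on_linear_comp[OF bounded_linear_inner_left V.open_image_Int[OF openin_chart] this]
  show "smooth_on (d ` (V \<inter> U)) ((\<lambda>q. c q \<bullet> b) \<circ> inv_into V d)"
    by (simp add: o_def)
qed

text \<open>Coordinate functions read off the parameter u. Injectivity of
  \<open>chart_vector\<close>, uniqueness of the anchor and the reduction of smoothness to
  components all rest on this.\<close>

lemma chart_vector_coord:
  assumes "p \<in> U"
  shows "chart_vector M U c p u (\<lambda>q. c q \<bullet> b) = u \<bullet> b"
proof -
  have "smooth_near M p (\<lambda>q. c q \<bullet> b)"
    using assms openin_chart smooth_fun_on_coord unfolding smooth_near_def by blast
  moreover have "((\<lambda>x. x \<bullet> b) has_derivative (\<lambda>u. u \<bullet> b)) (at (c p))"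
    by (auto intro!: derivative_eq_intros)
  then have "(((\<lambda>q. c q \<bullet> b) \<circ> ci) has_derivative (\<lambda>u. u \<bullet> b)) (at (c p))"
    by (rule has_derivative_transform_within_open[OF _ open_chart_image]) (use assms in auto)
  ultimately show ?thesis
    by (simp add: chart_vector_def frechet_derivativeI)
qed

lemma chart_vector_inject:
  assumes "p \<in> U"
  shows "chart_vector M U c p u = chart_vector M U c p w \<longleftrightarrow> u = w"
  by (metis chart_vector_coord[OF assms] vector_eq_rdot)

text \<open>All tangent vectors at p share the same guard \<open>smooth_near M p f\<close>, so
  pointwise combination is right also on functions where they take the value 0 by default.\<close>

lemma chart_vector_linear:
  assumes "p \<in> U"
  shows "chart_vector M U c p (a *\<^sub>R u + b *\<^sub>R w)
    = (\<lambda>f. a * chart_vector M U c p u f + b * chart_vector M U c p w f)"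
proof
  fix f
  show "chart_vector M U c p (a *\<^sub>R u + b *\<^sub>R w) f
    = a * chart_vector M U c p u f + b * chart_vector M U c p w f"
  proof (cases "smooth_near M p f")
    case True
    have "linear (frechet_derivative (f \<circ> ci) (at (c p)))"
      using smooth_near_has_derivative[OF assms True] has_derivative_linear by blast
    then show ?thesis
      using True by (simp add: chart_vector_def linear_add linear_scale)
  qed (simp add: chart_vector_def)
qed

lemma chart_vector_zero: "p \<in> U \<Longrightarrow> chart_vector M U c p 0 = (\<lambda>f. 0)"
  using chart_vector_linear[of p 0 0 0 0] by simp

text \<open>The point to check is that a combination of tangent vectors is again tangent; otherwise
  \<open>diff_at\<close> would return its default 0 there and linearity would fail.\<close>

lemma diff_at_in_cotangent_space:
  assumes "p \<in> U"
  shows "diff_at M f p \<in> cotangent_space M p"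
proof -
  have "(\<lambda>f. a * v f + b * w f) \<in> tangent_space M p"
    if vw: "v \<in> tangent_space M p" "w \<in> tangent_space M p" for v w a b
  proof -
    obtain u u' where "v = chart_vector M U c p u" "w = chart_vector M U c p u'"
      using vw tangent_space_eq[OF assms] by auto
    then show ?thesis
      using chart_vector_linear[OF assms, of a u b u'] chart_vector_in_tangent_space[OF assms] by metis
  qed
  then show ?thesis
    by (simp add: cotangent_space_def diff_at_def)
qed

lemma diff_at_coord_chart_vector:
  "p \<in> U \<Longrightarrow> diff_at M (\<lambda>q. c q \<bullet> b) p (chart_vector M U c p u) = u \<bullet> b"
  by (simp add: diff_at_def chart_vector_in_tangent_space chart_vector_coord)

lemma linear_cotangent_chart_vector:
  assumes p: "p \<in> U" and \<alpha>: "\<alpha> \<in> cotangent_space M p"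
  shows "linear (\<lambda>u. \<alpha> (chart_vector M U c p u))"
proof -
  have *: "\<alpha> (chart_vector M U c p (a *\<^sub>R u + b *\<^sub>R w))
    = a * \<alpha> (chart_vector M U c p u) + b * \<alpha> (chart_vector M U c p w)" for a b u w
    unfolding chart_vector_linear[OF p]
    using \<alpha> chart_vector_in_tangent_space[OF p] by (simp add: cotangent_space_def)
  show ?thesis
    using *[of 1 _ 1] *[of _ _ 0] by (intro linearI) simp_all
qed

end

section \<open>Covectors and the anchor map\<close>

lemma manifold_chartE:
  assumes "smooth_atlas M" "p \<in> topspace (mtop M)"
  obtains U c where "manifold_chart M U c" "p \<in> U"
proof -
  obtain U c where "(U, c) \<in> atlas M" "p \<in> U"
    using assms(2) unfolding smooth_atlasD(1)[OF assms(1), symmetric] by auto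
  then show ?thesis
    using that assms(1) by (simp add: manifold_chart_def)
qed

lemma cotangent_space_combination:
  "\<lbrakk>\<alpha> \<in> cotangent_space M p; \<beta> \<in> cotangent_space M p\<rbrakk>
    \<Longrightarrow> (\<lambda>v. a * \<alpha> v + b * \<beta> v) \<in> cotangent_space M p"
  unfolding cotangent_space_def mem_Collect_eq
proof (intro conjI ballI allI impI)
  fix v w x y
  assume *: "(\<forall>v\<in>tangent_space M p. \<forall>w\<in>tangent_space M p. \<forall>a b.
      \<alpha> (\<lambda>f. a * v f + b * w f) = a * \<alpha> v + b * \<alpha> w) \<and> (\<forall>v. v \<notin> tangent_space M p \<longrightarrow> \<alpha> v = 0)"
    "(\<forall>v\<in>tangent_space M p. \<forall>w\<in>tangent_space M p. \<forall>a b.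
      \<beta> (\<lambda>f. a * v f + b * w f) = a * \<beta> v + b * \<beta> w) \<and> (\<forall>v. v \<notin> tangent_space M p \<longrightarrow> \<beta> v = 0)"
    and vw: "v \<in> tangent_space M p" "w \<in> tangent_space M p"
  have "\<alpha> (\<lambda>f. x * v f + y * w f) = x * \<alpha> v + y * \<alpha> w"
    "\<beta> (\<lambda>f. x * v f + y * w f) = x * \<beta> v + y * \<beta> w"
    using * vw by blast+
  then show "a * \<alpha> (\<lambda>f. x * v f + y * w f) + b * \<beta> (\<lambda>f. x * v f + y * w f)
      = x * (a * \<alpha> v + b * \<beta> v) + y * (a * \<alpha> w + b * \<beta> w)"
    by (simp add: algebra_simps)
qed auto

lemma zero_in_cotangent_space: "(\<lambda>v. 0) \<in> cotangent_space M p"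
  by (simp add: cotangent_space_def)

text \<open>\<open>bivector_field\<close> gives linearity in the first argument; antisymmetry
  transfers it to the second. Membership is carried through the induction because both laws are
  available for covectors only.\<close>

lemma bivector_field_sum_right:
  assumes P: "bivector_field M P" and p: "p \<in> topspace (mtop M)"
    and \<alpha>: "\<alpha> \<in> cotangent_space M p" and \<beta>: "\<And>i. i \<in> I \<Longrightarrow> \<beta> i \<in> cotangent_space M p"
    and fin: "finite I"
  shows "(\<lambda>v. \<Sum>i\<in>I. r i * \<beta> i v) \<in> cotangent_space M p \<and>
    P p \<alpha> (\<lambda>v. \<Sum>i\<in>I. r i * \<beta> i v) = (\<Sum>i\<in>I. r i * P p \<alpha> (\<beta> i))"
  using fin \<beta>
proof (induction I rule: finite_induct)
  have anti: "P p \<alpha> \<beta> = - P p \<beta> \<alpha>"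
    if "\<alpha> \<in> cotangent_space M p" "\<beta> \<in> cotangent_space M p" for \<alpha> \<beta>
    using P p that unfolding bivector_field_def by blast
  have lin: "P p \<alpha> (\<lambda>v. a * \<beta> v + b * \<gamma> v) = a * P p \<alpha> \<beta> + b * P p \<alpha> \<gamma>"
    if "\<beta> \<in> cotangent_space M p" "\<gamma> \<in> cotangent_space M p" for \<beta> \<gamma> a b
  proof -
    have "P p (\<lambda>v. a * \<beta> v + b * \<gamma> v) \<alpha> = a * P p \<beta> \<alpha> + b * P p \<gamma> \<alpha>"
      using P p \<alpha> that unfolding bivector_field_def by blast
    then show ?thesis
      using anti[OF \<alpha> cotangent_space_combination[OF that, of a b]] anti[OF \<alpha> that(1)] anti[OF \<alpha> that(2)]
      by (simp add: algebra_simps)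
  qed
  {
    case empty
    show ?case
      \<comment> \<open>The empty sum is the zero covector, here written as the combination of zero
        covectors with coefficients 0.\<close>
      using lin[OF zero_in_cotangent_space zero_in_cotangent_space, of 0 0]
      by (simp add: zero_in_cotangent_space)
  next
    case (insert i I)
    let ?s = "\<lambda>v. \<Sum>i\<in>I. r i * \<beta> i v"
    have s: "?s \<in> cotangent_space M p" "P p \<alpha> ?s = (\<Sum>i\<in>I. r i * P p \<alpha> (\<beta> i))"
      using insert by auto
    have i: "\<beta> i \<in> cotangent_space M p"
      using insert by auto
    have "(\<lambda>v. \<Sum>j\<in>insert i I. r j * \<beta> j v) = (\<lambda>v. r i * \<beta> i v + 1 * ?s v)"
      using insert.hyps by simp
    then show ?case
      using lin[OF i s(1), of "r i" 1] cotangent_space_combination[OF i s(1), of "r i" 1] s(2) insert.hyps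
      by simp
  }
qed

text \<open>Finite-dimensional duality: the functional \<open>P p \<alpha>\<close> is evaluation at
  one tangent vector, found from its values on the coordinate differentials. Unique existence makes
  the description in \<open>anchor\<close> denote that vector.\<close>

lemma anchor_spec:
  fixes M :: "('a, 'e::real_inner) mfd"
  assumes M: "smooth_atlas M" and P: "bivector_field M P" and p: "p \<in> topspace (mtop M)"
    and \<alpha>: "\<alpha> \<in> cotangent_space M p"
  shows "anchor M P p \<alpha> \<in> tangent_space M p \<and> (\<forall>\<beta>\<in>cotangent_space M p. \<beta> (anchor M P p \<alpha>) = P p \<alpha> \<beta>)"
proof -
  obtain U c where "manifold_chart M U c" and pU: "p \<in> U"
    by (rule manifold_chartE[OF M p])
  interpret manifold_chart M U c by fact
  obtain B :: "'e set" where B: "finite B" "\<And>u. (\<Sum>b\<in>B. (u \<bullet> b / (b \<bullet> b)) *\<^sub>R b) = u"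
    using orthogonal_expansion[OF M] by blast
  let ?dx = "\<lambda>b. diff_at M (\<lambda>q. c q \<bullet> b) p"
  let ?cv = "chart_vector M U c p"
  have dx: "?dx b \<in> cotangent_space M p" for b
    by (rule diff_at_in_cotangent_space[OF pU])
  \<comment> \<open>Expansion in the coordinate differentials. It must be an equality of functions,
    since it is substituted into \<open>P p \<alpha>\<close>; off the tangent space both sides are
    0.\<close>
  have expand: "\<beta> = (\<lambda>v. \<Sum>b\<in>B. (\<beta> (?cv b) / (b \<bullet> b)) * ?dx b v)"
    if \<beta>: "\<beta> \<in> cotangent_space M p" for \<beta>
  proof
    fix v
    show "\<beta> v = (\<Sum>b\<in>B. (\<beta> (?cv b) / (b \<bullet> b)) * ?dx b v)"
    proof (cases "v \<in> tangent_space M p")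
      case True
      then obtain u where u: "v = ?cv u"
        using tangent_space_eq[OF pU] by auto
      have "\<beta> (?cv (\<Sum>b\<in>B. (u \<bullet> b / (b \<bullet> b)) *\<^sub>R b)) = (\<Sum>b\<in>B. (u \<bullet> b / (b \<bullet> b)) * \<beta> (?cv b))"
        using linear_sum[OF linear_cotangent_chart_vector[OF pU \<beta>], of "\<lambda>b. (u \<bullet> b / (b \<bullet> b)) *\<^sub>R b" B]
          linear_scale[OF linear_cotangent_chart_vector[OF pU \<beta>]] by simp
      then show ?thesis
        by (simp add: u B(2) diff_at_coord_chart_vector[OF pU] mult.commute)
    next
      case False
      then show ?thesis
        using \<beta> by (simp add: cotangent_space_def diff_at_def)
    qed
  qed
  \<comment> \<open>The vector whose components are forced by testing against the coordinate
    differentials; dividing by \<open>b \<bullet> b\<close> accounts for B being orthogonal but not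
    normalised.\<close>
  define w where "w = (\<Sum>b\<in>B. (P p \<alpha> (?dx b) / (b \<bullet> b)) *\<^sub>R b)"
  have "\<exists>!v. v \<in> tangent_space M p \<and> (\<forall>\<beta>\<in>cotangent_space M p. \<beta> v = P p \<alpha> \<beta>)"
  proof (intro ex1I conjI ballI)
    show "?cv w \<in> tangent_space M p"
      by (rule chart_vector_in_tangent_space[OF pU])
    show w: "\<beta> (?cv w) = P p \<alpha> \<beta>" if \<beta>: "\<beta> \<in> cotangent_space M p" for \<beta>
    proof -
      have "\<beta> (?cv w) = (\<Sum>b\<in>B. (P p \<alpha> (?dx b) / (b \<bullet> b)) * \<beta> (?cv b))"
        unfolding w_def
        using linear_sum[OF linear_cotangent_chart_vector[OF pU \<beta>], of "\<lambda>b. (P p \<alpha> (?dx b) / (b \<bullet> b)) *\<^sub>R b" B]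
          linear_scale[OF linear_cotangent_chart_vector[OF pU \<beta>]] by simp
      also have "\<dots> = (\<Sum>b\<in>B. (\<beta> (?cv b) / (b \<bullet> b)) * P p \<alpha> (?dx b))"
        by (simp add: mult.commute)
      also have "\<dots> = P p \<alpha> (\<lambda>v. \<Sum>b\<in>B. (\<beta> (?cv b) / (b \<bullet> b)) * ?dx b v)"
        using conjunct2[OF bivector_field_sum_right[OF P p \<alpha> dx B(1)]] by (rule sym)
      finally show ?thesis
        using expand[OF \<beta>] by simp
    qed
    fix v assume v: "v \<in> tangent_space M p \<and> (\<forall>\<beta>\<in>cotangent_space M p. \<beta> v = P p \<alpha> \<beta>)"
    then obtain u where u: "v = ?cv u"
      using tangent_space_eq[OF pU] by auto
    \<comment> \<open>Uniqueness: the coordinate differentials are among the admissible test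
      covectors and determine u.\<close>
    have "u \<bullet> b = w \<bullet> b" for b
      using v w[OF dx[of b]] dx[of b] by (metis u diff_at_coord_chart_vector[OF pU])
    then show "v = ?cv w"
      using u by (metis vector_eq_rdot)
  qed
  then show ?thesis
    unfolding anchor_def by (rule theI')
qed

section \<open>Smooth functions, Hamiltonian fields and the Leibniz rule\<close>

lemma smooth_fun_on_cong:
  assumes M: "smooth_atlas M" and W: "openin (mtop M) W"
    and f: "smooth_fun_on M W f" and eq: "\<And>p. p \<in> W \<Longrightarrow> f p = g p"
  shows "smooth_fun_on M W g"
  unfolding smooth_fun_on_def
proof clarify
  fix U c assume "(U, c) \<in> atlas M"
  then interpret manifold_chart M U c
    using M by unfold_locales
  show "smooth_on (c ` (U \<inter> W)) (g \<circ> ci)"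
    by (rule smooth_on_cong[OF open_image_Int[OF W] smooth_fun_onD[OF f]]) (auto simp: eq)
qed

lemma smooth_fun_on_subset: "\<lbrakk>smooth_fun_on M W f; V \<subseteq> W\<rbrakk> \<Longrightarrow> smooth_fun_on M V f"
  unfolding smooth_fun_on_def
proof clarify
  fix U c assume *: "\<forall>(U, c)\<in>atlas M. smooth_on (c ` (U \<inter> W)) (f \<circ> inv_into U c)"
    and "V \<subseteq> W" and c: "(U, c) \<in> atlas M"
  then have "c ` (U \<inter> V) \<subseteq> c ` (U \<inter> W)"
    by (intro image_mono) blast
  then show "smooth_on (c ` (U \<inter> V)) (f \<circ> inv_into U c)"
    using bspec[OF * c] smooth_on_subset by simp
qed

lemma smooth_fun_on_mult:
  assumes M: "smooth_atlas M" and W: "openin (mtop M) W"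
    and "smooth_fun_on M W f" "smooth_fun_on M W g"
  shows "smooth_fun_on M W (\<lambda>p. f p * g p)"
  unfolding smooth_fun_on_def
proof clarify
  fix U c assume "(U, c) \<in> atlas M"
  then interpret manifold_chart M U c
    using M by unfold_locales
  show "smooth_on (c ` (U \<inter> W)) ((\<lambda>p. f p * g p) \<circ> ci)"
    using smooth_on_mult[OF open_image_Int[OF W] smooth_fun_onD[OF assms(3)] smooth_fun_onD[OF assms(4)]]
    by (simp add: o_def)
qed

lemma smooth_fun_on_minus:
  assumes M: "smooth_atlas M" and W: "openin (mtop M) W"
    and "smooth_fun_on M W f" "smooth_fun_on M W g"
  shows "smooth_fun_on M W (\<lambda>p. f p - g p)"
  unfolding smooth_fun_on_def
proof clarify
  fix U c assume "(U, c) \<in> atlas M"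
  then interpret manifold_chart M U c
    using M by unfold_locales
  show "smooth_on (c ` (U \<inter> W)) ((\<lambda>p. f p - g p) \<circ> ci)"
    using smooth_on_minus[OF open_image_Int[OF W] smooth_fun_onD[OF assms(3)] smooth_fun_onD[OF assms(4)]]
    by (simp add: o_def)
qed

text \<open>Testing the anchor against dg shows that the field sends g to P(df, dg). Its smoothness
  is then part of the smoothness of the bivector field, and no coordinate expression for the anchor
  is required.\<close>

lemma vector_field_hamiltonian_field:
  assumes M: "smooth_atlas M" and P: "bivector_field M P"
    and f: "smooth_fun_on M (topspace (mtop M)) f"
  shows "vector_field M (hamiltonian_field M P f)"
  unfolding vector_field_def
proof (intro conjI allI ballI impI)
  have spec: "hamiltonian_field M P f p \<in> tangent_space M p \<and>
      (\<forall>\<beta>\<in>cotangent_space M p. \<beta> (hamiltonian_field M P f p) = P p (diff_at M f p) \<beta>)"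
    and cot: "diff_at M g p \<in> cotangent_space M p"
    if p: "p \<in> topspace (mtop M)" for p g
  proof -
    obtain U c where "manifold_chart M U c" "p \<in> U"
      by (rule manifold_chartE[OF M p])
    then show cot: "diff_at M g p \<in> cotangent_space M p" for g
      using manifold_chart.diff_at_in_cotangent_space by metis
    show "hamiltonian_field M P f p \<in> tangent_space M p \<and>
      (\<forall>\<beta>\<in>cotangent_space M p. \<beta> (hamiltonian_field M P f p) = P p (diff_at M f p) \<beta>)"
      using anchor_spec[OF M P p cot] p by (simp add: hamiltonian_field_def)
  qed
  show "hamiltonian_field M P f p \<in> tangent_space M p" if "p \<in> topspace (mtop M)" for p
    using spec[OF that] by blast
  show "hamiltonian_field M P f p = (\<lambda>g. 0)" if "p \<notin> topspace (mtop M)" for p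
    using that by (simp add: hamiltonian_field_def)
  fix W g assume W: "openin (mtop M) W \<and> smooth_fun_on M W g"
  then have sub: "W \<subseteq> topspace (mtop M)"
    by (simp add: openin_subset)
  have "smooth_fun_on M W (\<lambda>p. P p (diff_at M f p) (diff_at M g p))"
    using P W smooth_fun_on_subset[OF f sub] unfolding bivector_field_def by blast
  moreover have "P p (diff_at M f p) (diff_at M g p) = hamiltonian_field M P f p g" if "p \<in> W" for p
    using spec[of p] cot[of p g] that sub by (metis diff_at_def subsetD)
  ultimately show "smooth_fun_on M W (\<lambda>p. hamiltonian_field M P f p g)"
    by (rule smooth_fun_on_cong[OF M conjunct1[OF W]])
qed

text \<open>The product rule in a chart. The common open set W guarantees that the product is itself
  smooth near p, so that v does not fall back on its default value.\<close>

lemma tangent_vector_mult: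
  assumes M: "smooth_atlas M" and p: "p \<in> topspace (mtop M)" and v: "v \<in> tangent_space M p"
    and W: "openin (mtop M) W" "p \<in> W" and f: "smooth_fun_on M W f" and g: "smooth_fun_on M W g"
  shows "v (\<lambda>q. f q * g q) = f p * v g + v f * g p"
proof -
  obtain U c where "manifold_chart M U c" and pU: "p \<in> U"
    by (rule manifold_chartE[OF M p])
  interpret manifold_chart M U c by fact
  obtain u where u: "v = chart_vector M U c p u"
    using v tangent_space_eq[OF pU] by auto
  have near: "smooth_near M p f" "smooth_near M p g" "smooth_near M p (\<lambda>q. f q * g q)"
    using W f g smooth_fun_on_mult[OF M W(1) f g] unfolding smooth_near_def by blast+
  show ?thesis
    using frechet_derivative_mult[OF smooth_near_has_derivative[OF pU near(1)]
        smooth_near_has_derivative[OF pU near(2)], of u] near pU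
    by (simp add: u chart_vector_def o_def)
qed

lemma tangent_vector_minus:
  assumes M: "smooth_atlas M" and p: "p \<in> topspace (mtop M)" and v: "v \<in> tangent_space M p"
    and W: "openin (mtop M) W" "p \<in> W" and f: "smooth_fun_on M W f" and g: "smooth_fun_on M W g"
  shows "v (\<lambda>q. f q - g q) = v f - v g"
proof -
  obtain U c where "manifold_chart M U c" and pU: "p \<in> U"
    by (rule manifold_chartE[OF M p])
  interpret manifold_chart M U c by fact
  obtain u where u: "v = chart_vector M U c p u"
    using v tangent_space_eq[OF pU] by auto
  have near: "smooth_near M p f" "smooth_near M p g" "smooth_near M p (\<lambda>q. f q - g q)"
    using W f g smooth_fun_on_minus[OF M W(1) f g] unfolding smooth_near_def by blast+
  show ?thesis
    using frechet_derivativeI[OF has_derivative_diff[OF smooth_near_has_derivative[OF pU near(1)]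
        smooth_near_has_derivative[OF pU near(2)]]] near
    by (simp add: u chart_vector_def o_def)
qed

text \<open>Smoothness needs to be tested on chart components only: by the orthogonal expansion, Z f
  is a sum of components of Z times directional derivatives of f along the members of B.\<close>

lemma vector_fieldI:
  fixes M :: "('a, 'e::real_inner) mfd"
  assumes M: "smooth_atlas M"
    and Z: "\<And>p. p \<in> topspace (mtop M) \<Longrightarrow> Z p \<in> tangent_space M p"
    and Z0: "\<And>p. p \<notin> topspace (mtop M) \<Longrightarrow> Z p = (\<lambda>f. 0)"
    and sm: "\<And>U c b. (U, c) \<in> atlas M \<Longrightarrow>
      smooth_on (c ` U) (\<lambda>x. Z (inv_into U c x) (\<lambda>q. c q \<bullet> b))"
  shows "vector_field M Z"
  unfolding vector_field_def
proof (intro conjI ballI allI impI)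
  fix W f assume W: "openin (mtop M) W \<and> smooth_fun_on M W f"
  obtain B :: "'e set" where B: "finite B" "\<And>u. (\<Sum>b\<in>B. (u \<bullet> b / (b \<bullet> b)) *\<^sub>R b) = u"
    using orthogonal_expansion[OF M] by blast
  show "smooth_fun_on M W (\<lambda>p. Z p f)"
    unfolding smooth_fun_on_def
  proof clarify
    fix U c assume c: "(U, c) \<in> atlas M"
    then interpret manifold_chart M U c
      using M by unfold_locales
    let ?S = "c ` (U \<inter> W)"
    let ?D = "\<lambda>x. frechet_derivative (f \<circ> ci) (at x)"
    have S: "open ?S"
      using open_image_Int W by blast
    have F: "smooth_on ?S (f \<circ> ci)"
      using smooth_fun_onD W by blast
    have Zc: "smooth_on ?S (\<lambda>x. Z (ci x) (\<lambda>q. c q \<bullet> b))" for b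
      by (rule smooth_on_subset[OF sm[OF c]]) blast
    have "smooth_on ?S (\<lambda>x. \<Sum>b\<in>B. inverse (b \<bullet> b) * (Z (ci x) (\<lambda>q. c q \<bullet> b) * ?D x b))"
      by (intro smooth_on_sum smooth_on_mult smooth_on_const S Zc smooth_on_deriv[OF F])
    moreover have "(\<Sum>b\<in>B. inverse (b \<bullet> b) * (Z (ci x) (\<lambda>q. c q \<bullet> b) * ?D x b)) = Z (ci x) f"
      if x: "x \<in> ?S" for x
    proof -
      obtain p where p: "p \<in> U" "p \<in> W" "x = c p"
        using x by auto
      have near: "smooth_near M p f"
        using W p unfolding smooth_near_def by blast
      obtain u where u: "Z p = chart_vector M U c p u"
        using Z[of p] p(1) chart_subset tangent_space_eq[OF p(1)] by auto
      have lin: "linear (?D (c p))"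
        using has_derivative_linear[OF smooth_near_has_derivative[OF p(1) near]] .
      have "Z p f = ?D (c p) (\<Sum>b\<in>B. (u \<bullet> b / (b \<bullet> b)) *\<^sub>R b)"
        using near by (simp add: u chart_vector_def B(2))
      also have "\<dots> = (\<Sum>b\<in>B. (u \<bullet> b / (b \<bullet> b)) * ?D (c p) b)"
        using linear_sum[OF lin, of "\<lambda>b. (u \<bullet> b / (b \<bullet> b)) *\<^sub>R b" B] linear_scale[OF lin] by simp
      also have "\<dots> = (\<Sum>b\<in>B. inverse (b \<bullet> b) * ((u \<bullet> b) * ?D (c p) b))"
        by (simp add: field_simps)
      finally show ?thesis
        using p by (simp add: u chart_vector_coord[OF p(1)])
    qed
    ultimately show "smooth_on ?S ((\<lambda>p. Z p f) \<circ> ci)"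
      unfolding comp_def[of "\<lambda>p. Z p f" ci] by (rule smooth_on_cong[OF S])
  qed
qed (use Z Z0 in auto)

subsection \<open>Products and lifts\<close>

lemma inv_into_map_prod:
  assumes "inj_on c U" "inj_on d V" "x \<in> c ` U" "y \<in> d ` V"
  shows "inv_into (U \<times> V) (map_prod c d) (x, y) = (inv_into U c x, inv_into V d y)"
proof -
  obtain p q where "p \<in> U" "x = c p" "q \<in> V" "y = d q"
    using assms(3,4) by auto
  then show ?thesis
    using inv_into_f_f[OF map_prod_inj_on[OF assms(1,2)], of "(p, q)"] assms(1,2) by simp
qed

lemma homeomorphic_map_map_prod:
  assumes "homeomorphic_map X X' f" "homeomorphic_map Y Y' g"
  shows "homeomorphic_map (prod_topology X Y) (prod_topology X' Y') (map_prod f g)"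
proof -
  obtain f' g' where "homeomorphic_maps X X' f f'" "homeomorphic_maps Y Y' g g'"
    using assms by (auto simp: homeomorphic_map_maps)
  then have "homeomorphic_maps (prod_topology X Y) (prod_topology X' Y')
      (\<lambda>(x, y). (f x, g y)) (\<lambda>(x, y). (f' x, g' y))"
    by (simp add: homeomorphic_maps_prod)
  then show ?thesis
    by (auto simp: homeomorphic_map_maps map_prod_def)
qed

lemma span_Times_Un:
  fixes A :: "'e::real_vector set" and B :: "'f::real_vector set"
  assumes "span A = UNIV" "span B = UNIV"
  shows "span ((\<lambda>x. (x, 0)) ` A \<union> (\<lambda>y. (0, y)) ` B) = UNIV"
proof -
  let ?S = "(\<lambda>x. (x, 0)) ` A \<union> (\<lambda>y. (0, y)) ` B"
  have lin: "linear (\<lambda>x::'e. (x, 0::'f))" "linear (\<lambda>y::'f. (0::'e, y))"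
    by (auto intro!: linearI)
  have "range (\<lambda>x. (x, 0)) \<subseteq> span ?S" "range (\<lambda>y. (0, y)) \<subseteq> span ?S"
    unfolding assms[symmetric] span_linear_image[OF lin(1), symmetric] span_linear_image[OF lin(2), symmetric]
    by (intro span_mono Un_upper1 Un_upper2)+
  then have *: "(x, 0) \<in> span ?S" "(0, y) \<in> span ?S" for x y
    by blast+
  have "(x, y) \<in> span ?S" for x y
    using span_add[OF *(1)[of x] *(2)[of y]] by simp
  then show ?thesis
    by auto
qed

text \<open>Transition maps between product charts are pairs of transition maps of the factors, each
  depending on its own variable.\<close>

lemma smooth_atlas_prod_mfd:
  fixes M :: "('a, 'e::real_inner) mfd" and N :: "('b, 'f::real_inner) mfd"
  assumes M: "smooth_atlas M" and N: "smooth_atlas N"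
  shows "smooth_atlas (prod_mfd M N)"
proof -
  have "\<exists>B::('e \<times> 'f) set. finite B \<and> span B = UNIV"
  proof -
    obtain A :: "'e set" and B :: "'f set"
      where "finite A" "span A = UNIV" "finite B" "span B = UNIV"
      using conjunct1[OF M[unfolded smooth_atlas_def]] conjunct1[OF N[unfolded smooth_atlas_def]] by blast
    then show ?thesis
      by (intro exI[of _ "(\<lambda>x. (x, 0)) ` A \<union> (\<lambda>y. (0, y)) ` B"]) (simp add: span_Times_Un)
  qed
  moreover have "(\<Union>(U, c)\<in>atlas (prod_mfd M N). U) = topspace (mtop (prod_mfd M N))"
  proof -
    have "(\<Union>(U, c)\<in>atlas (prod_mfd M N). U)
        = (\<Union>(U, c)\<in>atlas M. U) \<times> (\<Union>(V, d)\<in>atlas N. V)" (is "?L = ?R")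
    proof (intro subset_antisym subsetI)
      show "z \<in> ?R" if "z \<in> ?L" for z
        using that by (auto simp: prod_mfd_def)
      fix z assume "z \<in> ?R"
      then obtain U c V d where "(U, c) \<in> atlas M" "fst z \<in> U" "(V, d) \<in> atlas N" "snd z \<in> V"
        by auto
      then have "(U \<times> V, map_prod c d) \<in> atlas (prod_mfd M N)" "z \<in> U \<times> V"
        by (auto simp: prod_mfd_def mem_Times_iff)
      then show "z \<in> ?L"
        by blast
    qed
    then show ?thesis
      by (simp add: smooth_atlasD(1)[OF M] smooth_atlasD(1)[OF N] prod_mfd_def)
  qed
  moreover have "openin (mtop (prod_mfd M N)) W \<and> open (k ` W) \<and>
      homeomorphic_map (subtopology (mtop (prod_mfd M N)) W) (top_of_set (k ` W)) k"
    if "(W, k) \<in> atlas (prod_mfd M N)" for W k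
  proof -
    obtain U V c d where c: "(U, c) \<in> atlas M" and d: "(V, d) \<in> atlas N"
      and Wk: "W = U \<times> V" "k = map_prod c d"
      using \<open>(W, k) \<in> atlas (prod_mfd M N)\<close> by (auto simp: prod_mfd_def)
    have kW: "k ` W = c ` U \<times> d ` V"
      unfolding Wk by (rule map_prod_surj_on[OF refl refl])
    have "homeomorphic_map (prod_topology (subtopology (mtop M) U) (subtopology (mtop N) V))
        (prod_topology (top_of_set (c ` U)) (top_of_set (d ` V))) k"
      unfolding Wk using smooth_atlasD(2)[OF M c] smooth_atlasD(2)[OF N d]
      by (intro homeomorphic_map_map_prod) auto
    then show ?thesis
      using smooth_atlasD(2)[OF M c] smooth_atlasD(2)[OF N d] unfolding kW
      by (simp add: Wk prod_mfd_def openin_prod_Times_iff open_Times subtopology_Times)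
  qed
  moreover have "smooth_on (k ` (W \<inter> W')) (k' \<circ> inv_into W k)"
    if W: "(W, k) \<in> atlas (prod_mfd M N)" and W': "(W', k') \<in> atlas (prod_mfd M N)" for W k W' k'
  proof -
    obtain U V c d where c: "(U, c) \<in> atlas M" and d: "(V, d) \<in> atlas N"
      and Wk: "W = U \<times> V" "k = map_prod c d"
      using W by (auto simp: prod_mfd_def)
    obtain U' V' c' d' where c': "(U', c') \<in> atlas M" and d': "(V', d') \<in> atlas N"
      and Wk': "W' = U' \<times> V'" "k' = map_prod c' d'"
      using W' by (auto simp: prod_mfd_def)
    interpret c: manifold_chart M U c by unfold_locales (fact M, fact c)
    interpret d: manifold_chart N V d by unfold_locales (fact N, fact d)
    let ?S = "c ` (U \<inter> U')" and ?T = "d ` (V \<inter> V')"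
    have open_ST: "open ?S" "open ?T"
      using smooth_atlasD(2)[OF M c'] smooth_atlasD(2)[OF N d'] c.open_image_Int d.open_image_Int
      by auto
    have "k ` (W \<inter> W') = ?S \<times> ?T"
      unfolding Wk Wk' Times_Int_Times by (rule map_prod_surj_on[OF refl refl])
    moreover have "smooth_on (?S \<times> ?T)
      (\<lambda>z. ((c' \<circ> inv_into U c) (fst z), (d' \<circ> inv_into V d) (snd z)))"
      by (intro smooth_on_Pair smooth_on_fst smooth_on_snd open_Times open_ST
          smooth_atlasD(3)[OF M c c'] smooth_atlasD(3)[OF N d d'])
    then have "smooth_on (?S \<times> ?T) (k' \<circ> inv_into W k)"
    proof (rule smooth_on_cong[OF open_Times[OF open_ST]])
      fix z assume "z \<in> ?S \<times> ?T"
      then show "((c' \<circ> inv_into U c) (fst z), (d' \<circ> inv_into V d) (snd z)) = (k' \<circ> inv_into W k) z"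
        using inv_into_map_prod[OF c.inj_on_chart d.inj_on_chart, of "fst z" "snd z"]
        by (auto simp: Wk Wk')
    qed
    ultimately show ?thesis
      by simp
  qed
  ultimately show ?thesis
    unfolding smooth_atlas_def by (simp add: Ball_def)
qed

locale product_chart = fst: manifold_chart M U c + snd: manifold_chart N V d
  for M :: "('a, 'e::real_inner) mfd" and U c and N :: "('b, 'f::real_inner) mfd" and V d
begin

sublocale prod: manifold_chart "prod_mfd M N" "U \<times> V" "map_prod c d"
proof
  show "smooth_atlas (prod_mfd M N)"
    by (rule smooth_atlas_prod_mfd[OF fst.smooth_atlas snd.smooth_atlas])
  show "(U \<times> V, map_prod c d) \<in> atlas (prod_mfd M N)"
    using fst.chart snd.chart by (auto simp: prod_mfd_def)
qed

lemma prod_ci: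
  "\<lbrakk>x \<in> c ` U; y \<in> d ` V\<rbrakk> \<Longrightarrow> prod.ci (x, y) = (fst.ci x, snd.ci y)"
  by (rule inv_into_map_prod[OF fst.inj_on_chart snd.inj_on_chart])

lemma image_Times: "map_prod c d ` (A \<times> B) = c ` A \<times> d ` B"
  by (rule map_prod_surj_on[OF refl refl])

end

lemma prod_atlasE:
  assumes "smooth_atlas M" "smooth_atlas N" "(W, k) \<in> atlas (prod_mfd M N)"
  obtains U c V d where "product_chart M U c N V d" "W = U \<times> V" "k = map_prod c d"
proof -
  obtain U V c d where "(U, c) \<in> atlas M" "(V, d) \<in> atlas N" "W = U \<times> V" "k = map_prod c d"
    using assms(3) by (auto simp: prod_mfd_def)
  then show ?thesis
    using that assms(1,2) by (simp add: product_chart_def manifold_chart_def)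
qed

text \<open>Needed to compute pushforwards under the projection: a tangent vector of the product is
  applied to \<open>g \<circ> fst\<close> and would give 0 by default were this function not smooth
  near the point.\<close>

lemma smooth_fun_on_fst:
  assumes M: "smooth_atlas M" and N: "smooth_atlas N"
    and W: "openin (mtop M) W" and f: "smooth_fun_on M W f"
  shows "smooth_fun_on (prod_mfd M N) (W \<times> topspace (mtop N)) (f \<circ> fst)"
  unfolding smooth_fun_on_def
proof clarify
  fix D k assume "(D, k) \<in> atlas (prod_mfd M N)"
  then obtain U c V d where "product_chart M U c N V d" and Dk: "D = U \<times> V" "k = map_prod c d"
    using prod_atlasE[OF M N] by blast
  interpret product_chart M U c N V d by fact
  let ?S = "c ` (U \<inter> W)" and ?T = "d ` (V \<inter> topspace (mtop N))"
  have o: "open ?S" "open ?T"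
    by (simp_all add: fst.open_image_Int[OF W] snd.open_image_Int)
  have "smooth_on (?S \<times> ?T) ((f \<circ> fst) \<circ> prod.ci)"
    by (rule smooth_on_cong[OF open_Times[OF o] smooth_on_fst[OF o fst.smooth_fun_onD[OF f]]])
      (auto simp: prod_ci)
  then show "smooth_on (k ` (D \<inter> W \<times> topspace (mtop N))) (f \<circ> fst \<circ> inv_into D k)"
    by (simp add: Dk Times_Int_Times image_Times)
qed

lemma smooth_fun_on_snd:
  assumes M: "smooth_atlas M" and N: "smooth_atlas N"
    and W: "openin (mtop N) W" and f: "smooth_fun_on N W f"
  shows "smooth_fun_on (prod_mfd M N) (topspace (mtop M) \<times> W) (f \<circ> snd)"
  unfolding smooth_fun_on_def
proof clarify
  fix D k assume "(D, k) \<in> atlas (prod_mfd M N)"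
  then obtain U c V d where "product_chart M U c N V d" and Dk: "D = U \<times> V" "k = map_prod c d"
    using prod_atlasE[OF M N] by blast
  interpret product_chart M U c N V d by fact
  let ?S = "c ` (U \<inter> topspace (mtop M))" and ?T = "d ` (V \<inter> W)"
  have o: "open ?S" "open ?T"
    by (simp_all add: fst.open_image_Int snd.open_image_Int[OF W])
  have "smooth_on (?S \<times> ?T) ((f \<circ> snd) \<circ> prod.ci)"
    by (rule smooth_on_cong[OF open_Times[OF o] smooth_on_snd[OF o snd.smooth_fun_onD[OF f]]])
      (auto simp: prod_ci)
  then show "smooth_on (k ` (D \<inter> topspace (mtop M) \<times> W)) (f \<circ> snd \<circ> inv_into D k)"
    by (simp add: Dk Times_Int_Times image_Times)
qed

context product_chart
begin

abbreviation "cv p q \<equiv> chart_vector (prod_mfd M N) (U \<times> V) (map_prod c d) (p, q)"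

text \<open>In product coordinates \<open>g \<circ> fst\<close> is the coordinate form of g after
  the first projection, so its derivative ignores w.\<close>

lemma pushforward_fst_chart_vector:
  assumes p: "p \<in> U" and q: "q \<in> V"
  shows "pushforward M fst (p, q) (cv p q (u, w)) = chart_vector M U c p u"
proof
  fix g
  show "pushforward M fst (p, q) (cv p q (u, w)) g = chart_vector M U c p u g"
  proof (cases "smooth_near M p g")
    case True
    then obtain W where W: "openin (mtop M) W" "p \<in> W" "smooth_fun_on M W g"
      unfolding smooth_near_def by blast
    have "openin (mtop (prod_mfd M N)) (W \<times> topspace (mtop N))"
      using W(1) by (simp add: prod_mfd_def openin_prod_Times_iff)
    moreover have "(p, q) \<in> W \<times> topspace (mtop N)"
      using W(2) q snd.chart_subset by auto
    ultimately have near: "smooth_near (prod_mfd M N) (p, q) (g \<circ> fst)"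
      using smooth_fun_on_fst[OF fst.smooth_atlas snd.smooth_atlas W(1,3)] unfolding smooth_near_def by blast
    let ?G = "frechet_derivative (g \<circ> fst.ci) (at (c p))"
    have "((\<lambda>z. (g \<circ> fst.ci) (fst z)) has_derivative (\<lambda>h. ?G (fst h))) (at (c p, d q))"
      by (rule has_derivative_compose[OF has_derivative_fst[OF has_derivative_ident]])
        (simp add: fst.smooth_near_has_derivative[OF p True, unfolded o_def] o_def)
    then have "((g \<circ> fst \<circ> prod.ci) has_derivative (\<lambda>h. ?G (fst h))) (at (c p, d q))"
      by (rule has_derivative_transform_within_open[OF _ open_Times[OF fst.open_chart_image snd.open_chart_image]])
        (use p q in \<open>auto simp: prod_ci\<close>)
    then show ?thesis
      using True near by (simp add: pushforward_def chart_vector_def frechet_derivativeI)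
  qed (simp add: pushforward_def chart_vector_def)
qed

lemma pushforward_snd_chart_vector:
  assumes p: "p \<in> U" and q: "q \<in> V"
  shows "pushforward N snd (p, q) (cv p q (u, w)) = chart_vector N V d q w"
proof
  fix g
  show "pushforward N snd (p, q) (cv p q (u, w)) g = chart_vector N V d q w g"
  proof (cases "smooth_near N q g")
    case True
    then obtain W where W: "openin (mtop N) W" "q \<in> W" "smooth_fun_on N W g"
      unfolding smooth_near_def by blast
    have "openin (mtop (prod_mfd M N)) (topspace (mtop M) \<times> W)"
      using W(1) by (simp add: prod_mfd_def openin_prod_Times_iff)
    moreover have "(p, q) \<in> topspace (mtop M) \<times> W"
      using W(2) p fst.chart_subset by auto
    ultimately have near: "smooth_near (prod_mfd M N) (p, q) (g \<circ> snd)"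
      using smooth_fun_on_snd[OF fst.smooth_atlas snd.smooth_atlas W(1,3)] unfolding smooth_near_def by blast
    let ?G = "frechet_derivative (g \<circ> snd.ci) (at (d q))"
    have "((\<lambda>z. (g \<circ> snd.ci) (snd z)) has_derivative (\<lambda>h. ?G (snd h))) (at (c p, d q))"
      by (rule has_derivative_compose[OF has_derivative_snd[OF has_derivative_ident]])
        (simp add: snd.smooth_near_has_derivative[OF q True, unfolded o_def] o_def)
    then have "((g \<circ> snd \<circ> prod.ci) has_derivative (\<lambda>h. ?G (snd h))) (at (c p, d q))"
      by (rule has_derivative_transform_within_open[OF _ open_Times[OF fst.open_chart_image snd.open_chart_image]])
        (use p q in \<open>auto simp: prod_ci\<close>)
    then show ?thesis
      using True near by (simp add: pushforward_def chart_vector_def frechet_derivativeI)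
  qed (simp add: pushforward_def chart_vector_def)
qed

text \<open>The two projections jointly determine a tangent vector of the product, because each
  recovers one component of its parameter. This is the pointwise uniqueness behind both
  lifts.\<close>

lemma product_tangent_vector_eqI:
  assumes p: "p \<in> U" and q: "q \<in> V" and v: "v \<in> tangent_space (prod_mfd M N) (p, q)"
    and "pushforward M fst (p, q) v = chart_vector M U c p u"
    and "pushforward N snd (p, q) v = chart_vector N V d q w"
  shows "v = cv p q (u, w)"
proof -
  have "(p, q) \<in> U \<times> V"
    using p q by simp
  then obtain h where "v = cv p q h"
    using v prod.tangent_space_eq by auto
  moreover obtain u' w' where "h = (u', w')"
    by (cases h)
  ultimately show ?thesis
    using assms(4,5) pushforward_fst_chart_vector[OF p q] pushforward_snd_chart_vector[OF p q]
      fst.chart_vector_inject[OF p] snd.chart_vector_inject[OF q] by simp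
qed

lemma cv_in_tangent_space:
  "\<lbrakk>p \<in> U; q \<in> V\<rbrakk> \<Longrightarrow> cv p q h \<in> tangent_space (prod_mfd M N) (p, q)"
  by (rule prod.chart_vector_in_tangent_space) simp

end

lemma product_chartE:
  assumes "smooth_atlas M" "smooth_atlas N" "(p, q) \<in> topspace (mtop (prod_mfd M N))"
  obtains U c V d where "product_chart M U c N V d" "p \<in> U" "q \<in> V"
proof -
  have pq: "p \<in> topspace (mtop M)" "q \<in> topspace (mtop N)"
    using assms(3) by (auto simp: prod_mfd_def)
  obtain U c where "manifold_chart M U c" "p \<in> U"
    by (rule manifold_chartE[OF assms(1) pq(1)])
  moreover obtain V d where "manifold_chart N V d" "q \<in> V"
    by (rule manifold_chartE[OF assms(2) pq(2)])
  ultimately show ?thesis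
    using that by (simp add: product_chart_def)
qed

section \<open>Existence and uniqueness of lifts\<close>

lemma vector_fieldD:
  assumes "vector_field M X"
  shows "p \<in> topspace (mtop M) \<Longrightarrow> X p \<in> tangent_space M p"
    and "p \<notin> topspace (mtop M) \<Longrightarrow> X p = (\<lambda>f. 0)"
    and "\<lbrakk>openin (mtop M) W; smooth_fun_on M W f\<rbrakk> \<Longrightarrow> smooth_fun_on M W (\<lambda>p. X p f)"
  using assms by (simp_all add: vector_field_def)

text \<open>Horizontal and vertical lifts are the cases \<open>Y = 0\<close> and \<open>X = 0\<close>.\<close>

definition lifts ::
  "('a, 'e::real_inner) mfd \<Rightarrow> ('b, 'f::real_inner) mfd \<Rightarrow> ('a \<Rightarrow> ('a \<Rightarrow> real) \<Rightarrow> real) \<Rightarrow>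
    ('b \<Rightarrow> ('b \<Rightarrow> real) \<Rightarrow> real) \<Rightarrow> ('a \<times> 'b \<Rightarrow> ('a \<times> 'b \<Rightarrow> real) \<Rightarrow> real) \<Rightarrow> bool" where
  "lifts M N X Y Z \<longleftrightarrow> vector_field (prod_mfd M N) Z \<and>
     (\<forall>z\<in>topspace (mtop (prod_mfd M N)).
        pushforward M fst z (Z z) = X (fst z) \<and> pushforward N snd z (Z z) = Y (snd z))"

lemma lifts_chart_vector:
  assumes "lifts M N X Y Z" "product_chart M U c N V d" and p: "p \<in> U" and q: "q \<in> V"
    and "X p = chart_vector M U c p u" "Y q = chart_vector N V d q w"
  shows "Z (p, q) = chart_vector (prod_mfd M N) (U \<times> V) (map_prod c d) (p, q) (u, w)"
proof -
  interpret product_chart M U c N V d by fact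
  have "(p, q) \<in> topspace (mtop (prod_mfd M N))"
    using p q prod.chart_subset by auto
  then show ?thesis
    using assms(1,5,6) vector_fieldD(1) by (intro product_tangent_vector_eqI[OF p q]) (auto simp: lifts_def)
qed

text \<open>The lift is chosen point by point from conditions that mention no chart, so nothing has
  to be glued. Afterwards pointwise uniqueness identifies it in each product chart, which gives
  smoothness and global uniqueness.\<close>

lemma lifts_ex1:
  fixes M :: "('a, 'e::real_inner) mfd" and N :: "('b, 'f::real_inner) mfd"
  assumes M: "smooth_atlas M" and N: "smooth_atlas N"
    and X: "vector_field M X" and Y: "vector_field N Y"
  shows "\<exists>!Z. lifts M N X Y Z"
proof -
  let ?P = "prod_mfd M N"
  have "\<exists>v. v \<in> tangent_space ?P z \<and> pushforward M fst z v = X (fst z) \<and> pushforward N snd z v = Y (snd z)"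
    if z: "z \<in> topspace (mtop ?P)" for z
  proof -
    obtain p q where pq: "z = (p, q)"
      by (cases z)
    obtain U c V d where "product_chart M U c N V d" and p: "p \<in> U" and q: "q \<in> V"
      using product_chartE[OF M N] z pq by blast
    interpret product_chart M U c N V d by fact
    obtain u w where "X p = chart_vector M U c p u" "Y q = chart_vector N V d q w"
      using vector_fieldD(1)[OF X, of p] vector_fieldD(1)[OF Y, of q] p q
        fst.chart_subset snd.chart_subset fst.tangent_space_eq[OF p] snd.tangent_space_eq[OF q] by blast
    then show ?thesis
      using cv_in_tangent_space[OF p q, of "(u, w)"] pushforward_fst_chart_vector[OF p q]
        pushforward_snd_chart_vector[OF p q] by (auto simp: pq)
  qed
  then obtain Z' where Z': "\<And>z. z \<in> topspace (mtop ?P) \<Longrightarrow> Z' z \<in> tangent_space ?P z \<and>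
      pushforward M fst z (Z' z) = X (fst z) \<and> pushforward N snd z (Z' z) = Y (snd z)"
    by metis
  \<comment> \<open>The value 0 off the product is demanded by \<open>vector_field\<close> and makes
    uniqueness an equality of functions.\<close>
  define Z where "Z z = (if z \<in> topspace (mtop ?P) then Z' z else (\<lambda>f. 0))" for z
  have "vector_field ?P Z"
  proof (rule vector_fieldI[OF smooth_atlas_prod_mfd[OF M N]])
    fix D k and b :: "'e \<times> 'f" assume "(D, k) \<in> atlas ?P"
    then obtain U c V d where "product_chart M U c N V d" and Dk: "D = U \<times> V" "k = map_prod c d"
      using prod_atlasE[OF M N] by blast
    interpret product_chart M U c N V d by fact
    obtain a b' where b: "b = (a, b')"
      by (cases b)
    \<comment> \<open>The inner product on the product space is the sum of those of the factors, so
      a component of the lift is a component of X in the first variable plus one of Y in the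
      second.\<close>
    let ?x = "\<lambda>x. X (fst.ci x) (\<lambda>q. c q \<bullet> a)" and ?y = "\<lambda>y. Y (snd.ci y) (\<lambda>q. d q \<bullet> b')"
    have "smooth_on (c ` U) ?x"
      using fst.smooth_fun_onD[OF vector_fieldD(3)[OF X fst.openin_chart fst.smooth_fun_on_coord[of a]]]
      by (simp add: o_def)
    moreover have "smooth_on (d ` V) ?y"
      using snd.smooth_fun_onD[OF vector_fieldD(3)[OF Y snd.openin_chart snd.smooth_fun_on_coord[of b']]]
      by (simp add: o_def)
    ultimately have "smooth_on (c ` U \<times> d ` V) (\<lambda>z. ?x (fst z) + ?y (snd z))"
      by (intro smooth_on_add smooth_on_fst smooth_on_snd open_Times fst.open_chart_image snd.open_chart_image)
    then have "smooth_on (c ` U \<times> d ` V) (\<lambda>x. Z (prod.ci x) (\<lambda>q. map_prod c d q \<bullet> b))"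
    proof (rule smooth_on_cong[OF open_Times[OF fst.open_chart_image snd.open_chart_image]])
      fix z assume "z \<in> c ` U \<times> d ` V"
      then obtain p q where p: "p \<in> U" and q: "q \<in> V" and z: "z = (c p, d q)"
        by auto
      obtain u w where uw: "X p = chart_vector M U c p u" "Y q = chart_vector N V d q w"
        using vector_fieldD(1)[OF X, of p] vector_fieldD(1)[OF Y, of q] p q
          fst.chart_subset snd.chart_subset fst.tangent_space_eq[OF p] snd.tangent_space_eq[OF q] by blast
      have top: "(p, q) \<in> topspace (mtop ?P)"
        using p q prod.chart_subset by auto
      have "Z (p, q) = cv p q (u, w)"
        using Z'[OF top] uw top by (intro product_tangent_vector_eqI[OF p q]) (auto simp: Z_def)
      then show "?x (fst z) + ?y (snd z) = Z (prod.ci z) (\<lambda>q. map_prod c d q \<bullet> b)"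
        using p q prod.chart_vector_coord[of "(p, q)" "(u, w)" b]
        by (simp add: z b uw prod_ci fst.chart_vector_coord snd.chart_vector_coord)
    qed
    then show "smooth_on (k ` D) (\<lambda>x. Z (inv_into D k x) (\<lambda>q. k q \<bullet> b))"
      by (simp add: Dk image_Times)
  qed (use Z' in \<open>auto simp: Z_def\<close>)
  then have "lifts M N X Y Z"
    using Z' by (simp add: lifts_def Z_def)
  moreover have "Z1 = Z2" if Z1: "lifts M N X Y Z1" and Z2: "lifts M N X Y Z2" for Z1 Z2
  proof
    fix z
    show "Z1 z = Z2 z"
    proof (cases "z \<in> topspace (mtop ?P)")
      case True
      obtain p q where pq: "z = (p, q)"
        by (cases z)
      obtain U c V d where uc: "product_chart M U c N V d" and p: "p \<in> U" and q: "q \<in> V"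
        using product_chartE[OF M N] True pq by blast
      interpret product_chart M U c N V d by fact
      obtain u w where uw: "X p = chart_vector M U c p u" "Y q = chart_vector N V d q w"
        using vector_fieldD(1)[OF X, of p] vector_fieldD(1)[OF Y, of q] p q
          fst.chart_subset snd.chart_subset fst.tangent_space_eq[OF p] snd.tangent_space_eq[OF q] by blast
      show ?thesis
        unfolding pq using lifts_chart_vector[OF Z1 uc p q uw] lifts_chart_vector[OF Z2 uc p q uw] by simp
    next
      case False
      then show ?thesis
        using vector_fieldD(2)[OF conjunct1[OF Z1[unfolded lifts_def]] False]
          vector_fieldD(2)[OF conjunct1[OF Z2[unfolded lifts_def]] False] by simp
    qed
  qed
  ultimately show ?thesis
    by blast
qed

subsection \<open>Wedges of commuting vector fields\<close>

lemma vector_field_zero: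
  assumes M: "smooth_atlas M"
  shows "vector_field M (\<lambda>p f. 0)"
  unfolding vector_field_def
proof (intro conjI ballI allI impI)
  fix p assume "p \<in> topspace (mtop M)"
  then obtain U c where "manifold_chart M U c" and p: "p \<in> U"
    using manifold_chartE[OF M] by blast
  interpret manifold_chart M U c by fact
  show "(\<lambda>f. 0) \<in> tangent_space M p"
    using chart_vector_in_tangent_space[OF p, of 0] by (simp add: chart_vector_zero[OF p])
next
  fix W f assume W: "openin (mtop M) W \<and> smooth_fun_on M W f"
  show "smooth_fun_on M W (\<lambda>p. 0)"
    \<comment> \<open>The zero function is written as f - f.\<close>
    using smooth_fun_on_minus[OF M conjunct1[OF W] conjunct2[OF W] conjunct2[OF W]] by simp
qed simp

text \<open>In a product chart \<open>A\<close> differentiates in a direction \<open>(u(x), 0)\<close> and \<open>B\<close> in a direction \<open>(0, w(y))\<close>.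
  Along the line through a point in the direction of \<open>A\<close> only \<open>x\<close> moves, so \<open>w(y)\<close> may be frozen, and
  vice versa; what remains is the symmetry of second derivatives.\<close>

lemma lifts_commute:
  assumes M: "smooth_atlas M" and N: "smooth_atlas N"
    and X: "vector_field M X" and Y: "vector_field N Y"
    and A: "lifts M N X (\<lambda>q f. 0) A" and B: "lifts M N (\<lambda>p f. 0) Y B"
    and \<phi>: "smooth_fun_on (prod_mfd M N) (topspace (mtop (prod_mfd M N))) \<phi>"
    and z: "z \<in> topspace (mtop (prod_mfd M N))"
  shows "A z (\<lambda>z. B z \<phi>) = B z (\<lambda>z. A z \<phi>)"
proof -
  obtain p q where pq: "z = (p, q)"
    by (cases z)
  obtain U c V d where pc: "product_chart M U c N V d" and p: "p \<in> U" and q: "q \<in> V"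
    using product_chartE[OF M N] z pq by blast
  interpret product_chart M U c N V d by fact
  let ?P = "prod_mfd M N"
  obtain u where u: "X p = chart_vector M U c p u"
    using vector_fieldD(1)[OF X, of p] p fst.chart_subset fst.tangent_space_eq[OF p] by blast
  obtain w where w: "Y q = chart_vector N V d q w"
    using vector_fieldD(1)[OF Y, of q] q snd.chart_subset snd.tangent_space_eq[OF q] by blast
  \<comment> \<open>The same u serves for every q', and below the same w for every p'; only the two
    coordinate slices through the point (p, q) are ever needed.\<close>
  have Ac: "A (p, q') = cv p q' (u, 0)" if "q' \<in> V" for q'
    by (rule lifts_chart_vector[OF A pc p that u snd.chart_vector_zero[OF that, symmetric]])
  have Bc: "B (p', q) = cv p' q (0, w)" if "p' \<in> U" for p'
    by (rule lifts_chart_vector[OF B pc that q fst.chart_vector_zero[OF that, symmetric] w])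
  let ?S = "c ` U \<times> d ` V"
  let ?D = "\<lambda>h x. frechet_derivative (\<phi> \<circ> prod.ci) (at x) h"
  let ?k = "map_prod c d"
  have S: "open ?S" "(c p, d q) \<in> ?S"
    using p q by (auto intro: open_Times fst.open_chart_image snd.open_chart_image)
  have smooth_S: "smooth_on ?S (f \<circ> prod.ci)" if "smooth_fun_on ?P (topspace (mtop ?P)) f" for f
    using prod.smooth_fun_onD[OF that] prod.chart_subset by (simp add: Int_absorb2 image_Times)
  have near: "smooth_near ?P z f" if "smooth_fun_on ?P (topspace (mtop ?P)) f" "z \<in> U \<times> V" for f z
    unfolding smooth_near_def using that prod.chart_subset openin_topspace by blast
  have smA: "smooth_fun_on ?P (topspace (mtop ?P)) (\<lambda>z. A z \<phi>)"
    and smB: "smooth_fun_on ?P (topspace (mtop ?P)) (\<lambda>z. B z \<phi>)"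
    using A B vector_fieldD(3)[OF _ openin_topspace \<phi>] by (simp_all add: lifts_def)
  have cv_eq: "cv p q h f = frechet_derivative (f \<circ> prod.ci) (at (c p, d q)) h"
    if "smooth_fun_on ?P (topspace (mtop ?P)) f" "p \<in> U" "q \<in> V" for p q h f
    using near[OF that(1), of "(p, q)"] that(2,3) by (simp add: chart_vector_def)
  have "A z (\<lambda>z. B z \<phi>) = frechet_derivative ((\<lambda>z. B z \<phi>) \<circ> prod.ci) (at (c p, d q)) (u, 0)"
    unfolding pq Ac[OF q] by (rule cv_eq[OF smB p q])
  also have "\<dots> = frechet_derivative (?D (0, w)) (at (c p, d q)) (u, 0)"
  proof (rule frechet_derivative_eq_on_line[OF smooth_S[OF smB] smooth_on_deriv[OF smooth_S[OF \<phi>]] S])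
    fix t assume "(c p, d q) + t *\<^sub>R (u, 0) \<in> ?S"
    then obtain p' where p': "p' \<in> U" "(c p, d q) + t *\<^sub>R (u, 0) = (c p', d q)"
      by auto
    show "((\<lambda>z. B z \<phi>) \<circ> prod.ci) ((c p, d q) + t *\<^sub>R (u, 0)) = ?D (0, w) ((c p, d q) + t *\<^sub>R (u, 0))"
      unfolding p'(2) using p'(1) q by (simp add: prod_ci Bc cv_eq[OF \<phi>])
  qed
  also have "\<dots> = frechet_derivative (?D (u, 0)) (at (c p, d q)) (0, w)"
    by (rule symmetric_second_derivative[OF smooth_S[OF \<phi>] S])
  also have "\<dots> = frechet_derivative ((\<lambda>z. A z \<phi>) \<circ> prod.ci) (at (c p, d q)) (0, w)"
  proof (rule sym, rule frechet_derivative_eq_on_line[OF smooth_S[OF smA] smooth_on_deriv[OF smooth_S[OF \<phi>]] S])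
    fix t assume "(c p, d q) + t *\<^sub>R (0, w) \<in> ?S"
    then obtain q' where q': "q' \<in> V" "(c p, d q) + t *\<^sub>R (0, w) = (c p, d q')"
      by auto
    show "((\<lambda>z. A z \<phi>) \<circ> prod.ci) ((c p, d q) + t *\<^sub>R (0, w)) = ?D (u, 0) ((c p, d q) + t *\<^sub>R (0, w))"
      unfolding q'(2) using q'(1) p by (simp add: prod_ci Ac cv_eq[OF \<phi>])
  qed
  also have "\<dots> = B z (\<lambda>z. A z \<phi>)"
    unfolding pq Bc[OF p] by (rule cv_eq[OF smA p q, symmetric])
  finally show ?thesis .
qed

text \<open>Holds as an equality of functions for arbitrary \<phi> and \<psi>: off the manifold both
  sides vanish with the fields. It can therefore be rewritten inside an outer bracket.\<close>

lemma bracket_wedge: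
  assumes A: "vector_field M A" and B: "vector_field M B"
  shows "bracket M (wedge A B) \<phi> \<psi> = (\<lambda>p. A p \<phi> * B p \<psi> - B p \<phi> * A p \<psi>)"
proof
  fix p
  have "diff_at M f p (Z p) = Z p f" if "vector_field M Z" for Z f
    using vector_fieldD(1,2)[OF that, of p] by (cases "p \<in> topspace (mtop M)") (auto simp: diff_at_def)
  then show "bracket M (wedge A B) \<phi> \<psi> p = A p \<phi> * B p \<psi> - B p \<phi> * A p \<psi>"
    using A B by (simp add: bracket_def wedge_def)
qed

lemma bivector_field_wedge:
  assumes M: "smooth_atlas M" and A: "vector_field M A" and B: "vector_field M B"
  shows "bivector_field M (wedge A B)"
  unfolding bivector_field_def
proof (intro conjI ballI allI impI)
  fix W f g assume W: "openin (mtop M) W \<and> smooth_fun_on M W f \<and> smooth_fun_on M W g"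
  have "smooth_fun_on M W (\<lambda>p. A p f * B p g - B p f * A p g)"
    using W by (intro smooth_fun_on_minus smooth_fun_on_mult M vector_fieldD(3)[OF A] vector_fieldD(3)[OF B]) auto
  then show "smooth_fun_on M W (\<lambda>p. wedge A B p (diff_at M f p) (diff_at M g p))"
    using bracket_wedge[OF A B, of f g] by (simp add: bracket_def)
qed (simp_all add: wedge_def algebra_simps)

lemma poisson_tensor_wedge:
  assumes M: "smooth_atlas M" and A: "vector_field M A" and B: "vector_field M B"
    and comm: "\<And>\<phi> p. \<lbrakk>smooth_fun_on M (topspace (mtop M)) \<phi>; p \<in> topspace (mtop M)\<rbrakk>
      \<Longrightarrow> A p (\<lambda>q. B q \<phi>) = B p (\<lambda>q. A q \<phi>)"
  shows "poisson_tensor M (wedge A B)"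
  unfolding poisson_tensor_def
proof (intro conjI allI impI ballI)
  show "bivector_field M (wedge A B)"
    by (rule bivector_field_wedge[OF M A B])
  fix \<phi> \<psi> \<theta> p
  let ?T = "topspace (mtop M)"
  assume sm: "smooth_fun_on M ?T \<phi> \<and> smooth_fun_on M ?T \<psi> \<and> smooth_fun_on M ?T \<theta>" and p: "p \<in> ?T"
  note smA = vector_fieldD(3)[OF A openin_topspace] and smB = vector_fieldD(3)[OF B openin_topspace]
  have Leibniz: "Z p (\<lambda>q. A q f * B q g - B q f * A q g)
      = A p f * Z p (\<lambda>q. B q g) + Z p (\<lambda>q. A q f) * B p g
        - (B p f * Z p (\<lambda>q. A q g) + Z p (\<lambda>q. B q f) * A p g)"
    if Z: "vector_field M Z" and f: "smooth_fun_on M ?T f" and g: "smooth_fun_on M ?T g" for Z f g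
  proof -
    note v = vector_fieldD(1)[OF Z p]
    show ?thesis
      using tangent_vector_minus[OF M p v openin_topspace p
          smooth_fun_on_mult[OF M openin_topspace smA[OF f] smB[OF g]]
          smooth_fun_on_mult[OF M openin_topspace smB[OF f] smA[OF g]]]
        tangent_vector_mult[OF M p v openin_topspace p smA[OF f] smB[OF g]]
        tangent_vector_mult[OF M p v openin_topspace p smB[OF f] smA[OF g]]
      by simp
  qed
  \<comment> \<open>\<open>comm\<close> turns A(Bg) into B(Ag) and A(Bf) into B(Af), leaving only
    the second-order terms AA, BA and BB. Matching terms of the cyclic sum are then literally equal,
    and the Jacobi identity becomes polynomial arithmetic.\<close>
  have br: "bracket M (wedge A B) (bracket M (wedge A B) f g) h p
      = (A p f * B p (\<lambda>q. A q g) + A p (\<lambda>q. A q f) * B p g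
        - (B p f * A p (\<lambda>q. A q g) + B p (\<lambda>q. A q f) * A p g)) * B p h
      - (A p f * B p (\<lambda>q. B q g) + B p (\<lambda>q. A q f) * B p g
        - (B p f * B p (\<lambda>q. A q g) + B p (\<lambda>q. B q f) * A p g)) * A p h"
    if f: "smooth_fun_on M ?T f" and g: "smooth_fun_on M ?T g" for f g h
    unfolding bracket_wedge[OF A B] Leibniz[OF A f g] Leibniz[OF B f g] comm[OF f p] comm[OF g p] ..
  show "bracket M (wedge A B) (bracket M (wedge A B) \<phi> \<psi>) \<theta> p
      + bracket M (wedge A B) (bracket M (wedge A B) \<psi> \<theta>) \<phi> p
      + bracket M (wedge A B) (bracket M (wedge A B) \<theta> \<phi>) \<psi> p = 0"
    using sm by (simp only: br) (simp add: algebra_simps)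
qed

theorem proposition6:
  fixes M1 :: "('a, 'e::real_inner) mfd" and M2 :: "('b, 'f::real_inner) mfd"
    and P1 :: "'a bivector_family" and P2 :: "'b bivector_family"
    and f1 :: "'a \<Rightarrow> real" and f2 :: "'b \<Rightarrow> real"
  assumes "smooth_manifold M1" and "smooth_manifold M2"
    and "bivector_field M1 P1" and "bivector_field M2 P2"
    and "smooth_fun_on M1 (topspace (mtop M1)) f1"
    and "smooth_fun_on M2 (topspace (mtop M2)) f2"
  shows "poisson_tensor (prod_mfd M1 M2)
           (wedge (horizontal_lift M1 M2 (hamiltonian_field M1 P1 f1))
                  (vertical_lift M1 M2 (hamiltonian_field M2 P2 f2)))"
proof -
  have M: "smooth_atlas M1" "smooth_atlas M2"
    using assms(1,2) by (simp_all add: smooth_manifold_imp_smooth_atlas)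
  let ?X = "hamiltonian_field M1 P1 f1" and ?Y = "hamiltonian_field M2 P2 f2"
  have X: "vector_field M1 ?X"
    by (rule vector_field_hamiltonian_field[OF M(1) assms(3,5)])
  have Y: "vector_field M2 ?Y"
    by (rule vector_field_hamiltonian_field[OF M(2) assms(4,6)])
  \<comment> \<open>Lifting with a zero partner field is exactly the condition in the definite
    description, so unique existence yields its defining property.\<close>
  have h: "lifts M1 M2 ?X (\<lambda>q f. 0) (horizontal_lift M1 M2 ?X)"
    using theI'[OF lifts_ex1[OF M X vector_field_zero[OF M(2)]]]
    by (simp add: horizontal_lift_def lifts_def)
  have v: "lifts M1 M2 (\<lambda>p f. 0) ?Y (vertical_lift M1 M2 ?Y)"
    using theI'[OF lifts_ex1[OF M vector_field_zero[OF M(1)] Y]]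
    by (simp add: vertical_lift_def lifts_def)
  show ?thesis
  proof (rule poisson_tensor_wedge[OF smooth_atlas_prod_mfd[OF M]])
    show "vector_field (prod_mfd M1 M2) (horizontal_lift M1 M2 ?X)"
      "vector_field (prod_mfd M1 M2) (vertical_lift M1 M2 ?Y)"
      using h v by (simp_all add: lifts_def)
  qed (rule lifts_commute[OF M X Y h v])
qed

end
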